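(* Let $p$ be an odd prime and let $G$ be an extra-special $p$-group of exponent $p$. Let $M$ be an elementary abelian $p$-group which is also a right $G$-module. Suppose that $M^G$ and $[M,G]$ coincide and have order $p$, and that $d(M)\ge d(G)$. Then there exists a derivation $\delta:G\rightarrow M$ such that $\delta(\gamma_2(G))\neq 1$.
   Context: A finite $p$-group $G$ is extra-special if $Z(G)=\gamma_2(G)=\Phi(G)$ has order $p$, where $\gamma_2(G)=[G,G]$ and $\Phi(G)$ is the Frattini subgroup. $M$ is written multiplicatively with the action of $g\in G$ on $m\in M$ written $m^g$. $M^G=\{m\in M : m^g=m \text{ for all } g\in G\}$, and $[M,G]$ is the submodule generated by the elements $m^{-1}m^g$ for $m\in M$, $g\in G$. $d(\cdot)$ denotes the minimal number of generators as a group. A derivation $\delta:G\to M$ is a function with $\delta(gh)=\delta(g)^h\,\delta(h)$ for all $g,h\in G$. The condition $\delta(\gamma_2(G))\ne 1$ means that $\delta$ is not identically trivial on $\gamma_2(G)$. *)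

theory Defs
  imports "HOL-Algebra.Algebra" "HOL-Library.Extended_Nat" "HOL-Computational_Algebra.Primes"
begin

definition is_p_group :: "nat \<Rightarrow> ('a, 'b) monoid_scheme \<Rightarrow> bool" where
  "is_p_group p G \<longleftrightarrow> group G \<and> (\<exists>n. order G = p ^ n)"

definition group_center :: "('a, 'b) monoid_scheme \<Rightarrow> 'a set" where
  "group_center G = {z \<in> carrier G. \<forall>g \<in> carrier G. z \<otimes>\<^bsub>G\<^esub> g = g \<otimes>\<^bsub>G\<^esub> z}"

abbreviation gamma2 :: "('a, 'b) monoid_scheme \<Rightarrow> 'a set" where
  "gamma2 G \<equiv> derived G (carrier G)"

definition maximal_subgroup :: "'a set \<Rightarrow> ('a, 'b) monoid_scheme \<Rightarrow> bool" where
  "maximal_subgroup H G \<longleftrightarrow>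
     subgroup H G \<and> H \<noteq> carrier G \<and>
     (\<forall>K. subgroup K G \<longrightarrow> H \<subseteq> K \<longrightarrow> K = H \<or> K = carrier G)"

text \<open>Intersecting with the carrier gives the usual convention that the Frattini subgroup
  of a group without maximal subgroups is the whole group.\<close>
definition frattini :: "('a, 'b) monoid_scheme \<Rightarrow> 'a set" where
  "frattini G = carrier G \<inter> \<Inter> {H. maximal_subgroup H G}"

definition extra_special :: "nat \<Rightarrow> ('a, 'b) monoid_scheme \<Rightarrow> bool" where
  "extra_special p G \<longleftrightarrow>
     is_p_group p G \<and> group_center G = gamma2 G \<and> gamma2 G = frattini G \<and>
     card (group_center G) = p"

text \<open>The value 0 stands for a group without finite exponent.\<close>
definition group_exponent :: "('a, 'b) monoid_scheme \<Rightarrow> nat" where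
  "group_exponent G =
     (if \<exists>n::nat>0. \<forall>x \<in> carrier G. x [^]\<^bsub>G\<^esub> n = \<one>\<^bsub>G\<^esub>
      then LEAST n::nat. n > 0 \<and> (\<forall>x \<in> carrier G. x [^]\<^bsub>G\<^esub> n = \<one>\<^bsub>G\<^esub>) else 0)"

text \<open>Finiteness is not part of the definition.\<close>
definition elementary_abelian :: "nat \<Rightarrow> ('a, 'b) monoid_scheme \<Rightarrow> bool" where
  "elementary_abelian p M \<longleftrightarrow> comm_group M \<and> (\<forall>x \<in> carrier M. x [^]\<^bsub>M\<^esub> p = \<one>\<^bsub>M\<^esub>)"

text \<open>The value is \<open>\<infinity>\<close> if the group is not finitely generated.\<close>
definition min_gens :: "('a, 'b) monoid_scheme \<Rightarrow> enat" where
  "min_gens G =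
     (INF S \<in> {S. finite S \<and> S \<subseteq> carrier G \<and> generate G S = carrier G}. enat (card S))"

text \<open>The argument order of \<open>act\<close> is that of the exponential notation: \<open>act m g\<close> is $m^g$.\<close>
locale right_group_module = G: group G + M: comm_group M
  for G :: "('g, 'c) monoid_scheme" (structure)
    and M :: "('m, 'd) monoid_scheme" (structure)
    and act :: "'m \<Rightarrow> 'g \<Rightarrow> 'm" +
  assumes act_closed: "\<lbrakk>m \<in> carrier M; g \<in> carrier G\<rbrakk> \<Longrightarrow> act m g \<in> carrier M"
    and act_one: "m \<in> carrier M \<Longrightarrow> act m \<one>\<^bsub>G\<^esub> = m"
    and act_mult: "\<lbrakk>m \<in> carrier M; g \<in> carrier G; h \<in> carrier G\<rbrakk>
      \<Longrightarrow> act m (g \<otimes>\<^bsub>G\<^esub> h) = act (act m g) h"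
    and act_distrib: "\<lbrakk>m \<in> carrier M; n \<in> carrier M; g \<in> carrier G\<rbrakk>
      \<Longrightarrow> act (m \<otimes>\<^bsub>M\<^esub> n) g = act m g \<otimes>\<^bsub>M\<^esub> act n g"

definition fixed_points ::
  "('g, 'c) monoid_scheme \<Rightarrow> ('m, 'd) monoid_scheme \<Rightarrow> ('m \<Rightarrow> 'g \<Rightarrow> 'm) \<Rightarrow> 'm set" where
  "fixed_points G M act = {m \<in> carrier M. \<forall>g \<in> carrier G. act m g = m}"

definition group_submodule ::
  "'m set \<Rightarrow> ('g, 'c) monoid_scheme \<Rightarrow> ('m, 'd) monoid_scheme \<Rightarrow> ('m \<Rightarrow> 'g \<Rightarrow> 'm) \<Rightarrow> bool" where
  "group_submodule N G M act \<longleftrightarrow>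
     subgroup N M \<and> (\<forall>n \<in> N. \<forall>g \<in> carrier G. act n g \<in> N)"

definition module_commutator ::
  "('g, 'c) monoid_scheme \<Rightarrow> ('m, 'd) monoid_scheme \<Rightarrow> ('m \<Rightarrow> 'g \<Rightarrow> 'm) \<Rightarrow> 'm set" where
  "module_commutator G M act =
     \<Inter> {N. group_submodule N G M act \<and>
        {inv\<^bsub>M\<^esub> m \<otimes>\<^bsub>M\<^esub> act m g | m g. m \<in> carrier M \<and> g \<in> carrier G} \<subseteq> N}"

definition is_derivation ::
  "('g, 'c) monoid_scheme \<Rightarrow> ('m, 'd) monoid_scheme \<Rightarrow> ('m \<Rightarrow> 'g \<Rightarrow> 'm) \<Rightarrow> ('g \<Rightarrow> 'm) \<Rightarrow> bool" where
  "is_derivation G M act \<delta> \<longleftrightarrow>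
     \<delta> \<in> carrier G \<rightarrow> carrier M \<and>
     (\<forall>g \<in> carrier G. \<forall>h \<in> carrier G. \<delta> (g \<otimes>\<^bsub>G\<^esub> h) = act (\<delta> g) h \<otimes>\<^bsub>M\<^esub> \<delta> h)"

end

theory Submission
  imports Defs "HOL-Number_Theory.Cong"
begin

text \<open>Write \<open>C\<close> for the group \<open>M\<^sup>G = [M, G]\<close> of order \<open>p\<close>, generated by \<open>c\<close>, and \<open>z\<close> for a
generator of \<open>Z(G) = \<gamma>\<^sub>2(G)\<close>. Commutators in \<open>G\<close> and the action on \<open>M\<close> become bilinear data over
the field with \<open>p\<close> elements: \<open>xy = yx z\<^sup>\<omega>\<close> with an alternating form \<open>\<omega>(x, y)\<close>, and
\<open>m\<^sup>g = m c\<^sup>b\<close> with a pairing \<open>b(m, g)\<close> whose left kernel is \<open>C\<close>. If \<open>f : G \<rightarrow> M\<close> is a homomorphism,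
then \<open>\<delta>(g) = f(g) c\<^bsup>q(g)\<^esup>\<close> is a derivation as soon as \<open>q(gh) - q(g) - q(h) = b(f(g), h)\<close>. So the
bilinear form \<open>b(f(g), h)\<close> has to be the coboundary of a function \<open>q\<close>, and \<open>q(z) \<noteq> 0\<close>, \<open>f(z) = 1\<close> are
wanted.

Two kinds of forms are coboundaries. A symmetric form is the polarisation of half of its
quadratic form, as \<open>p\<close> is odd. The form \<open>\<omega>\<close> is the coboundary of a function \<open>r\<close> with \<open>r(z) \<noteq> 0\<close>
(\<open>commutator_form_is_coboundary\<close>): by Lazard's trick, \<open>xy z\<^bsup>-\<omega>(x,y)/2\<^esup>\<close> is an elementary
abelian group structure on \<open>G\<close>, and twice a linear functional on it with value \<open>1\<close> at \<open>z\<close>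
serves as \<open>r\<close>. Hence it suffices to find \<open>f\<close> such that \<open>b(f(g), h) - \<omega>(g, h)\<close> is symmetric.

If every character \<open>G \<rightarrow> \<int>/p\<close> had the form \<open>b(m, \<cdot>)\<close>, then \<open>f\<close> could be chosen with
\<open>b(f(g), h) = \<omega>(g, h)\<close>. This can fail, but only by one dimension: \<open>G\<close> has at most \<open>p\<^bsup>d(G)\<^esup>\<close>
characters, while \<open>|M/C| \<ge> p\<^bsup>d(M)-1\<^esup> \<ge> p\<^bsup>d(G)-1\<^esup>\<close>. The missing dimension is supplied by the
coordinate \<open>\<rho> : M \<rightarrow> \<int>/p\<close> along \<open>C\<close> that a complement of \<open>C\<close> defines: for a suitable character
\<open>l\<close>, all characters have the form \<open>b(m, \<cdot>) + \<rho>(m) l\<close> (\<open>characters_represented\<close>). Let \<open>\<mu>(g)\<close>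
represent \<open>\<omega>(g, \<cdot>)\<close> in this way, put \<open>\<phi> = \<rho> \<circ> \<mu>\<close>, and let \<open>n\<close> represent the character \<open>\<phi>\<close>. Then
\<open>f(g) = \<mu>(g) n\<^bsup>-l(g)\<^esup>\<close> satisfies
\<open>b(f(g), h) = \<omega>(g, h) - \<phi>(g) l(h) - l(g) \<phi>(h) + \<rho>(n) l(g) l(h)\<close>,
whose deviation from \<open>\<omega>\<close> is symmetric, as required.\<close>

section \<open>Elements of prime exponent\<close>

lemma (in group) int_pow_cong:
  assumes "x \<in> carrier G" and "x [^] (p::nat) = \<one>" and "[a = b] (mod int p)"
  shows "x [^] (a::int) = x [^] b"
proof -
  obtain k where "a = b + int p * k"
    using assms(3) by (metis cong_iff_lin cong_sym)
  moreover have "x [^] (int p * k) = \<one>"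
    using assms(1,2) by (simp flip: int_pow_pow add: int_pow_int)
  ultimately show ?thesis
    using assms(1) by (simp add: int_pow_mult)
qed

text \<open>The exponent \<open>k\<close> is invertible modulo \<open>p\<close>, so \<open>x\<close> is itself a power of its \<open>k\<close>-th power.\<close>
lemma (in group) int_pow_mem_subgroup_imp_mem:
  assumes "Factorial_Ring.prime p" and "x \<in> carrier G" and "x [^] (p::nat) = \<one>"
    and "subgroup H G" and "x [^] (k::int) \<in> H" and "\<not> [k = 0] (mod int p)"
  shows "x \<in> H"
proof -
  have "coprime k (int p)"
    using assms(1,6) by (simp add: cong_0_iff coprime_commute[of k] prime_imp_coprime)
  then obtain j where "[k * j = 1] (mod int p)"
    using cong_solve_coprime_int by auto
  then have "x [^] (k * j) = x"
    using int_pow_cong[OF assms(2,3)] assms(2) by (metis int_pow_1)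
  moreover have "x [^] (k * j) \<in> H"
    using subgroup_int_pow_closed[OF assms(4,5)] assms(2) by (simp add: int_pow_pow)
  ultimately show ?thesis by simp
qed

lemma (in group) int_pow_eq_iff_cong:
  assumes "Factorial_Ring.prime p" and "x \<in> carrier G" and "x [^] (p::nat) = \<one>" and "x \<noteq> \<one>"
  shows "x [^] (a::int) = x [^] b \<longleftrightarrow> [a = b] (mod int p)"
proof
  assume "x [^] a = x [^] b"
  then have "x [^] (a - b) \<in> {\<one>}"
    using assms(2) by (simp add: int_pow_diff)
  then have "[a - b = 0] (mod int p)"
    using int_pow_mem_subgroup_imp_mem[OF assms(1-3) triv_subgroup] assms(4) by blast
  then show "[a = b] (mod int p)"
    by (simp add: cong_diff_iff_cong_0)
qed (use assms int_pow_cong in blast)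

lemma (in group) prime_order_subgroup_eq_powers:
  assumes "Factorial_Ring.prime p" and "subgroup H G" and "card H = p"
    and "x \<in> H" and "x [^] (p::nat) = \<one>" and "x \<noteq> \<one>"
  shows "H = range (\<lambda>k::int. x [^] k)"
proof -
  have x: "x \<in> carrier G"
    using assms(2,4) subgroup.mem_carrier by fast
  have sub: "range (\<lambda>k::int. x [^] k) \<subseteq> H"
    using subgroup_int_pow_closed[OF assms(2,4)] by auto
  have "inj_on (\<lambda>k::int. x [^] k) {0..<int p}"
    by (auto simp: inj_on_def int_pow_eq_iff_cong[OF assms(1) x assms(5,6)] cong_def)
  then have "card ((\<lambda>k::int. x [^] k) ` {0..<int p}) = card H"
    using assms(3) by (simp add: card_image)
  moreover have "finite H"
    using assms(1,3) by (metis card.infinite not_prime_0)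
  ultimately have "(\<lambda>k::int. x [^] k) ` {0..<int p} = H"
    using sub by (intro card_subset_eq) auto
  with sub show ?thesis by blast
qed

section \<open>Characters with values in the integers modulo a prime\<close>

text \<open>A homomorphism to \<open>\<int>/p\<close> is encoded by arbitrary integer representatives of its values: the
values serve as exponents, and \<open>p\<close> remains a variable.\<close>
definition mod_character :: "nat \<Rightarrow> ('a, 'b) monoid_scheme \<Rightarrow> ('a \<Rightarrow> int) \<Rightarrow> bool" where
  "mod_character p G \<phi> \<longleftrightarrow>
     (\<forall>x \<in> carrier G. \<forall>y \<in> carrier G. [\<phi> (x \<otimes>\<^bsub>G\<^esub> y) = \<phi> x + \<phi> y] (mod int p))"

lemma (in group) mod_character_one:
  assumes "mod_character p G \<phi>"
  shows "[\<phi> \<one> = 0] (mod int p)"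
proof -
  have "[\<phi> (\<one> \<otimes> \<one>) = \<phi> \<one> + \<phi> \<one>] (mod int p)"
    using assms unfolding mod_character_def by blast
  then show ?thesis by (simp add: cong_iff_dvd_diff)
qed

lemma (in group) mod_character_inv:
  assumes "mod_character p G \<phi>" and "x \<in> carrier G"
  shows "[\<phi> (inv x) = - \<phi> x] (mod int p)"
proof -
  have "[\<phi> (inv x \<otimes> x) = \<phi> (inv x) + \<phi> x] (mod int p)"
    using assms unfolding mod_character_def by blast
  then have "[\<phi> (inv x) + \<phi> x = 0] (mod int p)"
    using assms(2) mod_character_one[OF assms(1)] by (metis cong_sym cong_trans l_inv)
  then show ?thesis by (simp add: cong_iff_dvd_diff)
qed

lemma (in group) mod_character_int_pow:
  assumes "mod_character p G \<phi>" and "x \<in> carrier G"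
  shows "[\<phi> (x [^] (k::int)) = k * \<phi> x] (mod int p)"
proof -
  have nat: "[\<phi> (x [^] n) = int n * \<phi> x] (mod int p)" for n :: nat
  proof (induction n)
    case (Suc n)
    have "[\<phi> (x [^] Suc n) = \<phi> (x [^] n) + \<phi> x] (mod int p)"
      using assms by (simp add: mod_character_def)
    also have "[\<phi> (x [^] n) + \<phi> x = int n * \<phi> x + \<phi> x] (mod int p)"
      using Suc by (simp add: cong_add)
    finally show ?case by (simp add: algebra_simps)
  qed (simp add: mod_character_one[OF assms(1)])
  show ?thesis
  proof (cases "k \<ge> 0")
    case True
    then show ?thesis using nat[of "nat k"] by (simp flip: int_pow_int)
  next
    case False
    then have "x [^] k = inv (x [^] nat (- k))"
      using assms(2) int_pow_neg_int[of x "nat (- k)"] by simp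
    then have "[\<phi> (x [^] k) = - \<phi> (x [^] nat (- k))] (mod int p)"
      using mod_character_inv[OF assms(1), of "x [^] nat (- k)"] assms(2) by simp
    also have "[- \<phi> (x [^] nat (- k)) = - (int (nat (- k)) * \<phi> x)] (mod int p)"
      using nat[of "nat (- k)"] cong_minus_minus_iff by blast
    finally show ?thesis using False by simp
  qed
qed

lemma (in group) mod_character_cong_on_generate:
  assumes "mod_character p G \<phi>" and "mod_character p G \<psi>" and "S \<subseteq> carrier G"
    and "\<And>s. s \<in> S \<Longrightarrow> [\<phi> s = \<psi> s] (mod int p)" and "x \<in> generate G S"
  shows "[\<phi> x = \<psi> x] (mod int p)"
  using assms(5)
proof (induction rule: generate.induct)
  case one
  then show ?case
    using mod_character_one assms(1,2) by (metis cong_sym cong_trans)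
next
  case (inv h)
  then have h: "h \<in> carrier G" using assms(3) by blast
  have "[- \<phi> h = - \<psi> h] (mod int p)"
    using assms(4)[OF inv] cong_minus_minus_iff by blast
  then show ?case
    using mod_character_inv[OF assms(1) h] mod_character_inv[OF assms(2) h]
    by (meson cong_sym cong_trans)
next
  case (eng h1 h2)
  have "h1 \<in> carrier G" "h2 \<in> carrier G"
    using eng generate_in_carrier[OF assms(3)] by auto
  then have "[\<phi> (h1 \<otimes> h2) = \<phi> h1 + \<phi> h2] (mod int p)" "[\<psi> (h1 \<otimes> h2) = \<psi> h1 + \<psi> h2] (mod int p)"
    using assms(1,2) unfolding mod_character_def by auto
  with eng.IH show ?case
    by (meson cong_add cong_sym cong_trans)
qed (use assms in auto)

lemma (in group) mod_character_derived:
  assumes "mod_character p G \<phi>" and "x \<in> derived G (carrier G)"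
  shows "[\<phi> x = 0] (mod int p)"
proof (rule mod_character_cong_on_generate[where \<psi> = "\<lambda>_. 0"])
  show "derived_set G (carrier G) \<subseteq> carrier G" by auto
  show "x \<in> generate G (derived_set G (carrier G))"
    using assms(2) by (simp add: derived_def)
next
  fix s assume "s \<in> derived_set G (carrier G)"
  then obtain a b where ab: "a \<in> carrier G" "b \<in> carrier G" "s = a \<otimes> b \<otimes> inv a \<otimes> inv b"
    by auto
  have "[\<phi> s = \<phi> (a \<otimes> b \<otimes> inv a) + \<phi> (inv b)] (mod int p)"
    "[\<phi> (a \<otimes> b \<otimes> inv a) = \<phi> (a \<otimes> b) + \<phi> (inv a)] (mod int p)"
    "[\<phi> (a \<otimes> b) = \<phi> a + \<phi> b] (mod int p)"
    using ab assms(1) unfolding mod_character_def by auto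
  moreover have "[\<phi> (inv a) = - \<phi> a] (mod int p)" "[\<phi> (inv b) = - \<phi> b] (mod int p)"
    using ab mod_character_inv[OF assms(1)] by auto
  ultimately show "[\<phi> s = 0] (mod int p)"
    unfolding cong_iff_dvd_diff by Groebner_Basis.algebra
qed (use assms in \<open>auto simp: mod_character_def\<close>)

section \<open>Elementary abelian groups\<close>
lemma (in comm_group) subgroup_adjoin:
  assumes "subgroup H G" and "x \<in> carrier G"
  shows "subgroup {h \<otimes> x [^] (k::int) | h k. h \<in> H} G"
proof -
  interpret H: subgroup H G by fact
  show ?thesis
  proof (rule subgroupI)
    show "{h \<otimes> x [^] (k::int) | h k. h \<in> H} \<noteq> {}"
      using H.one_closed by blast
  next
    fix a assume "a \<in> {h \<otimes> x [^] (k::int) | h k. h \<in> H}"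
    then obtain h k where hk: "h \<in> H" "a = h \<otimes> x [^] (k::int)" by blast
    then have "inv a = inv h \<otimes> x [^] (- k)"
      using assms(2) by (simp add: inv_mult int_pow_neg)
    then show "inv a \<in> {h \<otimes> x [^] (k::int) | h k. h \<in> H}"
      using hk by blast
  next
    fix a a' assume "a \<in> {h \<otimes> x [^] (k::int) | h k. h \<in> H}" "a' \<in> {h \<otimes> x [^] (k::int) | h k. h \<in> H}"
    then obtain h k h' k' where hk: "h \<in> H" "a = h \<otimes> x [^] (k::int)"
      "h' \<in> H" "a' = h' \<otimes> x [^] (k'::int)" by blast
    then have "a \<otimes> a' = (h \<otimes> h') \<otimes> x [^] (k + k')"
      using assms(2) by (simp add: int_pow_mult m_ac)
    then show "a \<otimes> a' \<in> {h \<otimes> x [^] (k::int) | h k. h \<in> H}"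
      using hk by blast
  qed (use assms(2) in auto)
qed

lemma (in comm_group) adjoin_exponent_unique:
  assumes "Factorial_Ring.prime p" and "x \<in> carrier G" and "x [^] (p::nat) = \<one>"
    and "subgroup H G" and "x \<notin> H" and "h \<in> H" and "h' \<in> H"
    and "h \<otimes> x [^] (k::int) = h' \<otimes> x [^] k'"
  shows "[k = k'] (mod int p)"
proof -
  interpret H: subgroup H G by fact
  have h: "h \<in> carrier G" "h' \<in> carrier G"
    using assms(6,7) by auto
  then have "x [^] k = inv h \<otimes> (h' \<otimes> x [^] k')"
    using assms(2) by (simp add: inv_solve_left assms(8)[symmetric])
  then have "x [^] (k - k') = inv h \<otimes> h'"
    using assms(2) h by (simp add: int_pow_diff m_assoc)
  then have "x [^] (k - k') \<in> H"
    using assms by auto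
  then show ?thesis
    using int_pow_mem_subgroup_imp_mem assms(1-5) cong_diff_iff_cong_0 by blast
qed

text \<open>A linear functional that separates \<open>x\<close> from the identity: a subgroup \<open>H\<close> that is maximal among
those avoiding \<open>x\<close> is a complement of the group generated by \<open>x\<close>, and \<open>\<rho>\<close> is the coordinate along
\<open>x\<close>.\<close>
lemma exists_mod_character:
  fixes M (structure)
  assumes "Factorial_Ring.prime p" and "elementary_abelian p M" and "finite (carrier M)"
    and "x \<in> carrier M" and "x \<noteq> \<one>"
  obtains \<rho> where "mod_character p M \<rho>" and "[\<rho> x = 1] (mod int p)"
proof -
  interpret comm_group M using assms(2) by (simp add: elementary_abelian_def)
  have pow_p: "y [^] p = \<one>" if "y \<in> carrier M" for y
    using assms(2) that by (simp add: elementary_abelian_def)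
  let ?\<H> = "{H. subgroup H M \<and> x \<notin> H}"
  have fin_\<H>: "finite ?\<H>"
    by (rule finite_subset[of _ "Pow (carrier M)"]) (use assms(3) in \<open>auto dest: subgroup.subset\<close>)
  have triv_mem: "{\<one>} \<in> ?\<H>"
    using assms(5) triv_subgroup by auto
  obtain H where "H \<in> ?\<H>" and maximal: "\<forall>K\<in>?\<H>. H \<subseteq> K \<longrightarrow> H = K"
    using finite_has_maximal2[OF fin_\<H> triv_mem] by (elim bexE conjE) rule
  from this(1) have H: "subgroup H M" and xH: "x \<notin> H" by auto
  have max: "H = K" if "subgroup K M" "x \<notin> K" "H \<subseteq> K" for K
    using maximal[rule_format, of K] that by simp
  interpret H: subgroup H M by fact
  have decomp: "\<exists>h\<in>H. \<exists>k::int. y = h \<otimes> x [^] k" if y: "y \<in> carrier M" for y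
  proof (cases "y \<in> H")
    case True
    then show ?thesis
      using y by (metis int_pow_0 r_one)
  next
    case False
    define K where "K = {h \<otimes> y [^] (k::int) | h k. h \<in> H}"
    have KI: "h \<otimes> y [^] k \<in> K" if "h \<in> H" for h and k :: int
      using that unfolding K_def by blast
    have "H \<subseteq> K"
    proof
      fix h assume "h \<in> H"
      then show "h \<in> K" using KI[of h 0] by simp
    qed
    moreover have "y \<in> K"
      using KI[of "\<one>" 1] y by simp
    moreover have "subgroup K M"
      unfolding K_def by (rule subgroup_adjoin[OF H y])
    ultimately have "x \<in> K"
      using max[of K] False by fast
    then obtain h k where hk: "h \<in> H" "x = h \<otimes> y [^] (k::int)"
      unfolding K_def by blast
    have "\<not> [k = 0] (mod int p)"
      using hk xH y int_pow_cong[OF y pow_p[OF y], of k 0] by auto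
    then have "coprime k (int p)"
      using assms(1) by (simp add: cong_0_iff coprime_commute[of k] prime_imp_coprime)
    then obtain j where "[k * j = 1] (mod int p)"
      using cong_solve_coprime_int by auto
    then have "y [^] (k * j) = y"
      using int_pow_cong[OF y pow_p[OF y]] y by (metis int_pow_1)
    then have "x [^] j = h [^] j \<otimes> y"
      using hk y by (simp add: int_pow_distrib int_pow_pow)
    then have "y = inv (h [^] j) \<otimes> x [^] j"
      using y hk H.mem_carrier by (simp add: m_assoc[symmetric])
    then show ?thesis
      using subgroup_int_pow_closed[OF H hk(1)] by blast
  qed
  define \<rho> where "\<rho> y = (SOME k::int. \<exists>h\<in>H. y = h \<otimes> x [^] k)" for y
  have \<rho>: "\<exists>h\<in>H. y = h \<otimes> x [^] \<rho> y" if "y \<in> carrier M" for y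
    unfolding \<rho>_def by (rule someI_ex) (use decomp[OF that] in blast)
  have \<rho>_eq: "[\<rho> y = k] (mod int p)" if "h \<in> H" "y = h \<otimes> x [^] k" for y h k
    using adjoin_exponent_unique[OF assms(1,4) pow_p[OF assms(4)] H xH] \<rho>[of y] that assms(4)
    by (metis H.mem_carrier int_pow_closed m_closed)
  show ?thesis
  proof
    show "mod_character p M \<rho>"
      unfolding mod_character_def
    proof (intro ballI)
      fix y y' assume y: "y \<in> carrier M" "y' \<in> carrier M"
      obtain h h' where h: "h \<in> H" "h' \<in> H" "y = h \<otimes> x [^] \<rho> y" "y' = h' \<otimes> x [^] \<rho> y'"
        using \<rho>[OF y(1)] \<rho>[OF y(2)] by (elim bexE) rule
      have "y \<otimes> y' = (h \<otimes> x [^] \<rho> y) \<otimes> (h' \<otimes> x [^] \<rho> y')"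
        using h(3,4) by simp
      also have "\<dots> = (h \<otimes> h') \<otimes> x [^] (\<rho> y + \<rho> y')"
        using h(1,2) assms(4) by (simp add: int_pow_mult m_ac)
      finally show "[\<rho> (y \<otimes> y') = \<rho> y + \<rho> y'] (mod int p)"
        using \<rho>_eq h(1,2) by blast
    qed
    show "[\<rho> x = 1] (mod int p)"
      by (rule \<rho>_eq[of "\<one>"]) (use assms(4) in auto)
  qed
qed

text \<open>Adjoining an element outside a subgroup multiplies the order of the subgroup by at least \<open>p\<close>, so
a maximal set \<open>S\<close> among those that generate at least \<open>p\<close> to the power \<open>|S|\<close> elements generates
the whole group.\<close>
lemma exists_small_generating_set:
  fixes M (structure)
  assumes "Factorial_Ring.prime p" and "elementary_abelian p M" and "finite (carrier M)"
  obtains S where "finite S" and "S \<subseteq> carrier M" and "generate M S = carrier M"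
    and "p ^ card S \<le> card (carrier M)"
proof -
  interpret comm_group M using assms(2) by (simp add: elementary_abelian_def)
  have pow_p: "y [^] p = \<one>" if "y \<in> carrier M" for y
    using assms(2) that by (simp add: elementary_abelian_def)
  let ?\<S> = "{S. S \<subseteq> carrier M \<and> p ^ card S \<le> card (generate M S)}"
  have fin_\<S>: "finite ?\<S>"
    by (rule finite_subset[of _ "Pow (carrier M)"]) (use assms(3) in auto)
  have empty_mem: "{} \<in> ?\<S>"
    by (simp add: generate_empty)
  obtain S where "S \<in> ?\<S>" and max: "\<forall>T\<in>?\<S>. S \<subseteq> T \<longrightarrow> S = T"
    using finite_has_maximal2[OF fin_\<S> empty_mem] by (elim bexE conjE) rule
  from this(1) have S: "S \<subseteq> carrier M" and cardS: "p ^ card S \<le> card (generate M S)" by auto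
  have fin: "finite S" using S assms(3) finite_subset by blast
  have "generate M S = carrier M"
  proof (rule ccontr)
    assume "generate M S \<noteq> carrier M"
    then obtain x where x: "x \<in> carrier M" "x \<notin> generate M S"
      using generate_incl[OF S] by blast
    let ?f = "\<lambda>(h, k::int). h \<otimes> x [^] k"
    have sub: "subgroup (generate M S) M" by (rule generate_is_subgroup[OF S])
    have "inj_on ?f (generate M S \<times> {0..<int p})"
    proof (rule inj_onI, clarify)
      fix h h' and k k' :: int
      assume h: "h \<in> generate M S" "h' \<in> generate M S" and k: "k \<in> {0..<int p}" "k' \<in> {0..<int p}"
        and eq: "h \<otimes> x [^] k = h' \<otimes> x [^] k'"
      have "[k = k'] (mod int p)"
        by (rule adjoin_exponent_unique[OF assms(1) x(1) pow_p[OF x(1)] sub x(2) h eq])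
      then have "k = k'" using k by (simp add: cong_def)
      moreover from this have "h = h'"
        using eq h x(1) generate_in_carrier[OF S] by auto
      ultimately show "h = h' \<and> k = k'" by blast
    qed
    then have "card (?f ` (generate M S \<times> {0..<int p})) = card (generate M S) * p"
      by (simp add: card_image card_cartesian_product)
    moreover have "?f ` (generate M S \<times> {0..<int p}) \<subseteq> generate M (insert x S)"
    proof clarify
      fix h and k :: int
      assume "h \<in> generate M S"
      then have "h \<in> generate M (insert x S)"
        using mono_generate[of S "insert x S"] by blast
      moreover have "subgroup (generate M (insert x S)) M"
        using S x by (intro generate_is_subgroup) auto
      moreover from this have "x [^] k \<in> generate M (insert x S)"
        by (rule subgroup_int_pow_closed) (auto intro: generate.incl)
      ultimately show "h \<otimes> x [^] k \<in> generate M (insert x S)"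
        by (simp add: subgroup.m_closed)
    qed
    moreover have "finite (generate M (insert x S))"
      using S x assms(3) generate_incl[of "insert x S"] by (auto intro: finite_subset)
    ultimately have grow: "card (generate M S) * p \<le> card (generate M (insert x S))"
      by (metis card_mono)
    have xS: "x \<notin> S"
      using x by (auto intro: generate.incl)
    then have "p ^ card (insert x S) = p ^ card S * p"
      using fin by simp
    also have "\<dots> \<le> card (generate M S) * p"
      using cardS by (rule mult_le_mono1)
    also note grow
    finally have "p ^ card (insert x S) \<le> card (generate M (insert x S))" .
    then have "insert x S \<in> ?\<S>" using S x by auto
    then have "S = insert x S"
      by (rule max[rule_format]) blast
    then show False using xS by blast
  qed
  then show thesis
    using that[OF fin S] cardS by simp
qed

section \<open>Commutators in groups of class two and odd prime exponent\<close>


text \<open>All commutators are powers of the central element \<open>z\<close>, the commutator of \<open>x\<close> and \<open>y\<close> being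
\<open>z\<close> to the power \<open>\<omega> x y\<close>. Only the residue class of \<open>\<omega> x y\<close> is determined.\<close>
locale central_commutator_form = group G
  for G :: "('a, 'b) monoid_scheme" (structure) and p :: nat and z and \<omega> :: "'a \<Rightarrow> 'a \<Rightarrow> int" +
  assumes prime_p: "Factorial_Ring.prime p" and odd_p: "odd p"
    and exponent: "x \<in> carrier G \<Longrightarrow> x [^] p = \<one>"
    and z_closed: "z \<in> carrier G" and z_not_one: "z \<noteq> \<one>"
    and z_central: "x \<in> carrier G \<Longrightarrow> z \<otimes> x = x \<otimes> z"
    and commute: "\<lbrakk>x \<in> carrier G; y \<in> carrier G\<rbrakk> \<Longrightarrow> x \<otimes> y = y \<otimes> x \<otimes> z [^] \<omega> x y"
begin

lemma z_pow_closed: "z [^] (k::int) \<in> carrier G"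
  using z_closed by simp

lemma z_pow_eq_iff: "z [^] (a::int) = z [^] b \<longleftrightarrow> [a = b] (mod int p)"
  using int_pow_eq_iff_cong[OF prime_p z_closed exponent z_not_one] z_closed by simp

lemma z_nat_pow_central:
  assumes "x \<in> carrier G"
  shows "z [^] (n::nat) \<otimes> x = x \<otimes> z [^] n"
proof (induction n)
  case (Suc n)
  have "z [^] Suc n \<otimes> x = z [^] n \<otimes> (z \<otimes> x)"
    using assms z_closed by (simp add: m_assoc)
  also have "\<dots> = (z [^] n \<otimes> x) \<otimes> z"
    using assms z_closed by (simp add: m_assoc z_central)
  also have "\<dots> = x \<otimes> z [^] Suc n"
    unfolding Suc using assms z_closed by (simp add: m_assoc)
  finally show ?case .
qed (use assms in simp)

lemma z_pow_eq_nat_pow: "z [^] (k::int) = z [^] nat (k mod int p)"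
proof -
  have "[k = int (nat (k mod int p))] (mod int p)"
    using prime_p by (simp add: cong_def prime_gt_0_nat)
  then show ?thesis
    unfolding int_pow_int[symmetric] z_pow_eq_iff .
qed

lemma z_pow_central:
  assumes "x \<in> carrier G"
  shows "z [^] (k::int) \<otimes> x = x \<otimes> z [^] k"
  unfolding z_pow_eq_nat_pow[of k] by (rule z_nat_pow_central[OF assms])

lemma z_pow_move:
  assumes "x \<in> carrier G" and "y \<in> carrier G"
  shows "x \<otimes> z [^] (k::int) \<otimes> y = x \<otimes> y \<otimes> z [^] k"
  using assms z_pow_closed by (simp add: m_assoc z_pow_central)

lemma z_pow_append:
  assumes "x \<in> carrier G"
  shows "x \<otimes> z [^] (j::int) \<otimes> z [^] k = x \<otimes> z [^] (j + k)"
  using assms z_closed by (simp add: m_assoc int_pow_mult)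

lemma eq_z_pow_iff:
  assumes "x \<in> carrier G"
  shows "x \<otimes> z [^] (j::int) = x \<otimes> z [^] k \<longleftrightarrow> [j = k] (mod int p)"
  using assms z_closed by (simp add: z_pow_eq_iff)

text \<open>As \<open>z\<close> has order \<open>p\<close>, identities for \<open>\<omega>\<close> modulo \<open>p\<close> follow by comparing exponents of \<open>z\<close>.\<close>
lemma form_eqI:
  assumes "x \<in> carrier G" and "y \<in> carrier G" and "x \<otimes> y = y \<otimes> x \<otimes> z [^] k"
  shows "[\<omega> x y = k] (mod int p)"
  using assms commute[OF assms(1,2)] eq_z_pow_iff[of "y \<otimes> x" "\<omega> x y" k] by simp

lemma form_self: "x \<in> carrier G \<Longrightarrow> [\<omega> x x = 0] (mod int p)"
  by (rule form_eqI) auto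

lemma form_z_right: "x \<in> carrier G \<Longrightarrow> [\<omega> x (z [^] (k::int)) = 0] (mod int p)"
  by (rule form_eqI) (auto simp: z_pow_central z_closed)

lemma form_z_left: "x \<in> carrier G \<Longrightarrow> [\<omega> (z [^] (k::int)) x = 0] (mod int p)"
  by (rule form_eqI) (auto simp: z_pow_central z_closed)

lemma form_antisym:
  assumes "x \<in> carrier G" and "y \<in> carrier G"
  shows "[\<omega> x y = - \<omega> y x] (mod int p)"
proof (rule form_eqI)
  show "x \<otimes> y = y \<otimes> x \<otimes> z [^] - \<omega> y x"
    using assms by (simp add: commute[of y x] z_pow_append)
qed (use assms in auto)

lemma form_add_left:
  assumes "x \<in> carrier G" and "x' \<in> carrier G" and "y \<in> carrier G"
  shows "[\<omega> (x \<otimes> x') y = \<omega> x y + \<omega> x' y] (mod int p)"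
proof (rule form_eqI)
  have "x \<otimes> x' \<otimes> y = x \<otimes> y \<otimes> x' \<otimes> z [^] \<omega> x' y"
    using assms z_pow_closed by (simp add: m_assoc commute[of x' y])
  also have "x \<otimes> y \<otimes> x' = y \<otimes> (x \<otimes> x') \<otimes> z [^] \<omega> x y"
    using assms z_pow_move[of "y \<otimes> x" x'] by (simp add: m_assoc commute[of x y])
  finally show "x \<otimes> x' \<otimes> y = y \<otimes> (x \<otimes> x') \<otimes> z [^] (\<omega> x y + \<omega> x' y)"
    using assms z_pow_append[of "y \<otimes> (x \<otimes> x')"] by simp
qed (use assms in auto)

lemma mod_character_form_left: "y \<in> carrier G \<Longrightarrow> mod_character p G (\<lambda>x. \<omega> x y)"
  by (simp add: mod_character_def form_add_left)

lemma mod_character_form_right: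
  assumes "x \<in> carrier G"
  shows "mod_character p G (\<omega> x)"
  unfolding mod_character_def
proof (intro ballI)
  fix y y' assume y: "y \<in> carrier G" "y' \<in> carrier G"
  have "[\<omega> x (y \<otimes> y') = - \<omega> (y \<otimes> y') x] (mod int p)" "[\<omega> (y \<otimes> y') x = \<omega> y x + \<omega> y' x] (mod int p)"
    "[\<omega> x y = - \<omega> y x] (mod int p)" "[\<omega> x y' = - \<omega> y' x] (mod int p)"
    using assms y by (auto intro: form_antisym form_add_left)
  then show "[\<omega> x (y \<otimes> y') = \<omega> x y + \<omega> x y'] (mod int p)"
    unfolding cong_iff_dvd_diff by Groebner_Basis.algebra
qed

definition half :: int where "half = (int p + 1) div 2"

lemma two_half: "[2 * half = 1] (mod int p)"
proof -
  obtain k where "p = 2 * k + 1"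
    using odd_p by (rule oddE)
  then have "2 * half = int p + 1"
    unfolding half_def by simp
  then show ?thesis by (simp add: cong_def)
qed

text \<open>Lazard's (or Baer's) correspondence: dividing the product by the square root of the commutator makes
it commutative, and it stays associative because \<open>\<omega>\<close> is bilinear with \<open>z\<close> in its radical.\<close>
definition lazard_add (infixl "\<oplus>\<^sub>L" 65) where
  "x \<oplus>\<^sub>L y = x \<otimes> y \<otimes> z [^] (- half * \<omega> x y)"

definition lazard_group where
  "lazard_group = \<lparr>carrier = carrier G, monoid.mult = (\<oplus>\<^sub>L), one = \<one>\<rparr>"

lemma lazard_closed: "x \<in> carrier G \<Longrightarrow> y \<in> carrier G \<Longrightarrow> x \<oplus>\<^sub>L y \<in> carrier G"
  using z_closed by (simp add: lazard_add_def)

text \<open>The product of \<open>G\<close> is recovered from the abelian one by adding a power of \<open>z\<close>. Applied to a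
functional, this gives \<open>\<rho>(xy) = \<rho>(x) + \<rho>(y) + \<omega>(x, y) \<rho>(z) / 2\<close>.\<close>
lemma mult_eq_lazard_add:
  assumes "x \<in> carrier G" and "y \<in> carrier G"
  shows "x \<otimes> y = x \<oplus>\<^sub>L y \<oplus>\<^sub>L z [^] (half * \<omega> x y)"
proof -
  have "[\<omega> (x \<oplus>\<^sub>L y) (z [^] (half * \<omega> x y)) = 0] (mod int p)"
    by (rule form_z_right) (use assms lazard_closed in blast)
  then have "z [^] (- half * \<omega> (x \<oplus>\<^sub>L y) (z [^] (half * \<omega> x y))) = \<one>"
    using z_pow_eq_iff[of _ 0] cong_scalar_left[of _ 0 "int p" "- half"] by simp
  then have "x \<oplus>\<^sub>L y \<oplus>\<^sub>L z [^] (half * \<omega> x y) = (x \<oplus>\<^sub>L y) \<otimes> z [^] (half * \<omega> x y)"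
    unfolding lazard_add_def[of "x \<oplus>\<^sub>L y"] using assms lazard_closed z_closed by simp
  also have "\<dots> = x \<otimes> y"
    unfolding lazard_add_def[of x y] using assms by (simp add: z_pow_append)
  finally show ?thesis ..
qed

text \<open>As \<open>\<omega>\<close> is alternating, powers in the two groups agree, and so the exponent is inherited.\<close>
lemma lazard_add_self_pow:
  assumes "x \<in> carrier G"
  shows "x [^] n \<oplus>\<^sub>L x = x [^] Suc n"
proof -
  have "[\<omega> (x [^] int n) x = int n * \<omega> x x] (mod int p)"
    by (rule mod_character_int_pow[OF mod_character_form_left]) (use assms in auto)
  moreover have "[int n * \<omega> x x = 0] (mod int p)"
    using cong_scalar_left[OF form_self[OF assms], of "int n"] by simp
  ultimately have "[\<omega> (x [^] n) x = 0] (mod int p)"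
    by (metis cong_trans int_pow_int)
  then have "z [^] (- half * \<omega> (x [^] n) x) = \<one>"
    using z_pow_eq_iff[of _ 0] cong_scalar_left[of _ 0 "int p" "- half"] by simp
  then show ?thesis
    using assms by (simp add: lazard_add_def)
qed

lemma lazard_comm:
  assumes "x \<in> carrier G" and "y \<in> carrier G"
  shows "x \<oplus>\<^sub>L y = y \<oplus>\<^sub>L x"
proof -
  have "x \<oplus>\<^sub>L y = y \<otimes> x \<otimes> z [^] (\<omega> x y + - half * \<omega> x y)"
    using assms by (simp add: lazard_add_def commute[of x y] z_pow_append)
  also have "\<dots> = y \<otimes> x \<otimes> z [^] (- half * \<omega> y x)"
  proof -
    have "[\<omega> x y + - half * \<omega> x y = - half * \<omega> y x] (mod int p)"
    proof -
      obtain k l where "1 = 2 * half + int p * k" "- \<omega> y x = \<omega> x y + int p * l"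
        using two_half form_antisym[OF assms] unfolding cong_iff_lin by blast
      then have "- half * \<omega> y x = (\<omega> x y + - half * \<omega> x y) + int p * (half * l - k * \<omega> x y)"
        by Groebner_Basis.algebra
      then show ?thesis unfolding cong_iff_lin by blast
    qed
    then show ?thesis using assms eq_z_pow_iff by simp
  qed
  finally show ?thesis by (simp add: lazard_add_def)
qed

lemma lazard_assoc:
  assumes x: "x \<in> carrier G" and y: "y \<in> carrier G" and w: "w \<in> carrier G"
  shows "x \<oplus>\<^sub>L y \<oplus>\<^sub>L w = x \<oplus>\<^sub>L (y \<oplus>\<^sub>L w)"
proof -
  have form_mult_z: "[\<omega> (u \<otimes> z [^] (k::int)) v = \<omega> u v] (mod int p)"
    "[\<omega> v (u \<otimes> z [^] (k::int)) = \<omega> v u] (mod int p)"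
    if "u \<in> carrier G" "v \<in> carrier G" for u v k
    using form_add_left[OF that(1) z_pow_closed that(2)] form_z_left[OF that(2)]
      mod_character_form_right[OF that(2)] form_z_right[OF that(2)] that z_pow_closed
    unfolding mod_character_def by (smt (verit) cong_add_lcancel_0 cong_trans cong_add cong_refl add.right_neutral)+
  have "x \<oplus>\<^sub>L y \<oplus>\<^sub>L w = x \<otimes> y \<otimes> w \<otimes> z [^] (- half * \<omega> x y + - half * \<omega> (x \<oplus>\<^sub>L y) w)"
    unfolding lazard_add_def[of "x \<oplus>\<^sub>L y"]
    using assms by (simp add: lazard_add_def[of x y] z_pow_move z_pow_append)
  also have "\<dots> = x \<otimes> y \<otimes> w \<otimes> z [^] (- half * \<omega> y w + - half * \<omega> x (y \<oplus>\<^sub>L w))"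
  proof -
    have "[\<omega> (x \<oplus>\<^sub>L y) w = \<omega> (x \<otimes> y) w] (mod int p)" "[\<omega> x (y \<oplus>\<^sub>L w) = \<omega> x (y \<otimes> w)] (mod int p)"
      unfolding lazard_add_def using assms by (auto intro: form_mult_z)
    moreover have "[\<omega> (x \<otimes> y) w = \<omega> x w + \<omega> y w] (mod int p)" "[\<omega> x (y \<otimes> w) = \<omega> x y + \<omega> x w] (mod int p)"
      using assms form_add_left mod_character_form_right by (auto simp: mod_character_def)
    ultimately have "[- half * \<omega> x y + - half * \<omega> (x \<oplus>\<^sub>L y) w = - half * \<omega> y w + - half * \<omega> x (y \<oplus>\<^sub>L w)] (mod int p)"
      unfolding cong_iff_dvd_diff by Groebner_Basis.algebra
    then show ?thesis using assms eq_z_pow_iff by simp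
  qed
  also have "\<dots> = x \<oplus>\<^sub>L (y \<oplus>\<^sub>L w)"
  proof -
    have "x \<oplus>\<^sub>L (y \<oplus>\<^sub>L w) = x \<otimes> (y \<otimes> w \<otimes> z [^] (- half * \<omega> y w)) \<otimes> z [^] (- half * \<omega> x (y \<oplus>\<^sub>L w))"
      unfolding lazard_add_def[of x "y \<oplus>\<^sub>L w"] by (simp add: lazard_add_def[of y w])
    also have "x \<otimes> (y \<otimes> w \<otimes> z [^] (- half * \<omega> y w)) = x \<otimes> y \<otimes> w \<otimes> z [^] (- half * \<omega> y w)"
      using assms z_pow_closed by (simp add: m_assoc)
    finally show ?thesis using assms by (simp add: z_pow_append)
  qed
  finally show ?thesis .
qed

lemma lazard_comm_group: "comm_group lazard_group"
proof (rule comm_groupI)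
  fix x assume "x \<in> carrier lazard_group"
  then have x: "x \<in> carrier G" by (simp add: lazard_group_def)
  have "[\<omega> \<one> x = 0] (mod int p)"
    by (rule mod_character_one[OF mod_character_form_left[OF x]])
  then have "z [^] (- half * \<omega> \<one> x) = \<one>"
    using z_pow_eq_iff[of _ 0] cong_scalar_left[of _ 0 "int p" "- half"] by simp
  then show "\<one>\<^bsub>lazard_group\<^esub> \<otimes>\<^bsub>lazard_group\<^esub> x = x"
    using x by (simp add: lazard_group_def lazard_add_def)
  have "[\<omega> (inv x) x = - \<omega> x x] (mod int p)"
    by (rule mod_character_inv[OF mod_character_form_left[OF x] x])
  then have "[- half * \<omega> (inv x) x = 0] (mod int p)"
    using form_self[OF x] unfolding cong_iff_dvd_diff by Groebner_Basis.algebra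
  then have "z [^] (- half * \<omega> (inv x) x) = \<one>"
    using z_pow_eq_iff[of _ 0] by simp
  then have "inv x \<oplus>\<^sub>L x = \<one>"
    using x by (simp add: lazard_add_def)
  then show "\<exists>y\<in>carrier lazard_group. y \<otimes>\<^bsub>lazard_group\<^esub> x = \<one>\<^bsub>lazard_group\<^esub>"
    using x by (auto simp: lazard_group_def)
qed (auto simp: lazard_group_def lazard_closed lazard_assoc intro: lazard_comm)

lemma elementary_abelian_lazard_group: "elementary_abelian p lazard_group"
proof -
  have "x [^]\<^bsub>lazard_group\<^esub> n = x [^] n" if "x \<in> carrier G" for x and n :: nat
    by (induction n) (use lazard_add_self_pow[OF that] in \<open>auto simp: lazard_group_def nat_pow_def\<close>)
  then show ?thesis
    using lazard_comm_group exponent by (simp add: elementary_abelian_def lazard_group_def)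
qed

text \<open>In cohomological terms, \<open>\<omega>\<close> represents zero in the second cohomology of \<open>G\<close>. The function \<open>r\<close>
is twice a functional on the Lazard group that is \<open>1\<close> at \<open>z\<close>; the factor absorbs the \<open>1/2\<close> in
the coboundary of such a functional, and \<open>r z = 2\<close> is invertible.\<close>
theorem commutator_form_is_coboundary:
  assumes "finite (carrier G)"
  obtains r where
    "\<forall>x\<in>carrier G. \<forall>y\<in>carrier G. [r (x \<otimes> y) = r x + r y + \<omega> x y] (mod int p)"
    and "\<not> [r z = 0] (mod int p)"
proof -
  obtain \<rho> where \<rho>: "mod_character p lazard_group \<rho>" and \<rho>z: "[\<rho> z = 1] (mod int p)"
    by (rule exists_mod_character[OF prime_p elementary_abelian_lazard_group, of z])
      (use assms z_closed z_not_one in \<open>auto simp: lazard_group_def\<close>)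
  have \<rho>_add: "[\<rho> (x \<oplus>\<^sub>L y) = \<rho> x + \<rho> y] (mod int p)" if "x \<in> carrier G" "y \<in> carrier G" for x y
    using \<rho> that by (simp add: mod_character_def lazard_group_def)
  have \<rho>_one: "[\<rho> \<one> = 0] (mod int p)"
    using group.mod_character_one[OF comm_group.axioms(2)[OF lazard_comm_group] \<rho>]
    by (simp add: lazard_group_def)
  have \<rho>_nat_pow: "[\<rho> (z [^] n) = int n] (mod int p)" for n :: nat
  proof (induction n)
    case (Suc n)
    have "[\<rho> (z [^] Suc n) = \<rho> (z [^] n) + \<rho> z] (mod int p)"
      using \<rho>_add[of "z [^] n" z] z_closed lazard_add_self_pow[OF z_closed, of n] by simp
    with Suc \<rho>z show ?case
      unfolding cong_iff_dvd_diff of_nat_Suc by Groebner_Basis.algebra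
  qed (simp add: \<rho>_one)
  have \<rho>_pow: "[\<rho> (z [^] k) = k] (mod int p)" for k :: int
    using \<rho>_nat_pow[of "nat (k mod int p)"] prime_p
    unfolding z_pow_eq_nat_pow[of k] by (simp add: cong_def prime_gt_0_nat)
  show thesis
  proof (rule that, intro ballI)
    fix x y assume xy: "x \<in> carrier G" "y \<in> carrier G"
    have "[\<rho> (x \<otimes> y) = \<rho> (x \<oplus>\<^sub>L y) + \<rho> (z [^] (half * \<omega> x y))] (mod int p)"
      unfolding mult_eq_lazard_add[OF xy] by (intro \<rho>_add lazard_closed xy z_pow_closed)
    with \<rho>_add[OF xy] \<rho>_pow[of "half * \<omega> x y"] two_half
    show "[2 * \<rho> (x \<otimes> y) = 2 * \<rho> x + 2 * \<rho> y + \<omega> x y] (mod int p)"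
      unfolding cong_iff_dvd_diff by Groebner_Basis.algebra
  next
    show "\<not> [2 * \<rho> z = 0] (mod int p)"
    proof
      assume "[2 * \<rho> z = 0] (mod int p)"
      moreover have "[2 * \<rho> z = 2 * 1] (mod int p)"
        using \<rho>z by (rule cong_scalar_left)
      ultimately have "[2 = 0] (mod int p)"
        by (metis cong_sym cong_trans mult_1_right)
      then have "[2 * half = 0 * half] (mod int p)"
        by (rule cong_scalar_right)
      with two_half have "[1 = 0] (mod int p)"
        by (metis cong_sym cong_trans mult_zero_left)
      then show False using prime_p by (simp add: cong_0_iff)
    qed
  qed
qed

end

section \<open>Modules with cyclic commutator equal to the fixed points\<close>


text \<open>The situation \<open>[M, G] = M\<^sup>G\<close> of order \<open>p\<close> in coordinates: \<open>b m g\<close> is the logarithm to the base \<open>c\<close>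
of the displacement of \<open>m\<close> by \<open>g\<close>, determined modulo \<open>p\<close>.\<close>
locale cyclic_commutator_module = right_group_module G M act
  for G :: "('g, 'c) monoid_scheme" (structure) and M :: "('m, 'd) monoid_scheme" (structure)
    and act :: "'m \<Rightarrow> 'g \<Rightarrow> 'm" +
  fixes p :: nat and c :: 'm and b :: "'m \<Rightarrow> 'g \<Rightarrow> int"
  assumes prime_p: "Factorial_Ring.prime p"
    and elementary_abelian_M: "elementary_abelian p M"
    and c_closed: "c \<in> carrier M" and c_not_one: "c \<noteq> \<one>\<^bsub>M\<^esub>"
    and fixed_points_eq: "fixed_points G M act = range (\<lambda>k::int. c [^]\<^bsub>M\<^esub> k)"
    and act_eq: "\<lbrakk>m \<in> carrier M; g \<in> carrier G\<rbrakk> \<Longrightarrow> act m g = m \<otimes>\<^bsub>M\<^esub> c [^]\<^bsub>M\<^esub> b m g"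
begin

lemma exponent_M: "m \<in> carrier M \<Longrightarrow> m [^]\<^bsub>M\<^esub> p = \<one>\<^bsub>M\<^esub>"
  using elementary_abelian_M by (simp add: elementary_abelian_def)

lemma c_pow_closed: "c [^]\<^bsub>M\<^esub> (k::int) \<in> carrier M"
  using c_closed by simp

lemma c_pow_eq_iff: "c [^]\<^bsub>M\<^esub> (i::int) = c [^]\<^bsub>M\<^esub> j \<longleftrightarrow> [i = j] (mod int p)"
  using M.int_pow_eq_iff_cong[OF prime_p c_closed exponent_M c_not_one] c_closed by simp

lemma eq_c_pow_iff:
  assumes "m \<in> carrier M"
  shows "m \<otimes>\<^bsub>M\<^esub> c [^]\<^bsub>M\<^esub> (i::int) = m \<otimes>\<^bsub>M\<^esub> c [^]\<^bsub>M\<^esub> j \<longleftrightarrow> [i = j] (mod int p)"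
  using assms c_closed by (simp add: c_pow_eq_iff)

lemma act_c_pow:
  assumes "g \<in> carrier G"
  shows "act (c [^]\<^bsub>M\<^esub> (k::int)) g = c [^]\<^bsub>M\<^esub> k"
proof -
  have "c [^]\<^bsub>M\<^esub> k \<in> fixed_points G M act"
    unfolding fixed_points_eq by blast
  then show ?thesis
    using assms by (simp add: fixed_points_def)
qed

lemma pairing_eqI:
  assumes "m \<in> carrier M" and "g \<in> carrier G" and "act m g = m \<otimes>\<^bsub>M\<^esub> c [^]\<^bsub>M\<^esub> (k::int)"
  shows "[b m g = k] (mod int p)"
  using assms act_eq eq_c_pow_iff by simp

lemma mod_character_pairing_left:
  assumes g: "g \<in> carrier G"
  shows "mod_character p M (\<lambda>m. b m g)"
  unfolding mod_character_def
proof (intro ballI)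
  fix m n assume mn: "m \<in> carrier M" "n \<in> carrier M"
  have "act (m \<otimes>\<^bsub>M\<^esub> n) g = (m \<otimes>\<^bsub>M\<^esub> c [^]\<^bsub>M\<^esub> b m g) \<otimes>\<^bsub>M\<^esub> (n \<otimes>\<^bsub>M\<^esub> c [^]\<^bsub>M\<^esub> b n g)"
    using mn g act_distrib act_eq by simp
  also have "\<dots> = (m \<otimes>\<^bsub>M\<^esub> n) \<otimes>\<^bsub>M\<^esub> c [^]\<^bsub>M\<^esub> (b m g + b n g)"
    using mn c_closed by (simp add: M.int_pow_mult M.m_ac)
  finally show "[b (m \<otimes>\<^bsub>M\<^esub> n) g = b m g + b n g] (mod int p)"
    using mn g by (intro pairing_eqI) auto
qed

text \<open>Additivity in the group argument holds since \<open>G\<close> fixes the powers of \<open>c\<close>: acting by \<open>h\<close> does not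
change the displacement that \<open>g\<close> produced.\<close>
lemma mod_character_pairing_right:
  assumes m: "m \<in> carrier M"
  shows "mod_character p G (b m)"
  unfolding mod_character_def
proof (intro ballI)
  fix g h assume gh: "g \<in> carrier G" "h \<in> carrier G"
  have "act m (g \<otimes> h) = act m h \<otimes>\<^bsub>M\<^esub> c [^]\<^bsub>M\<^esub> b m g"
    using m gh c_closed by (simp add: act_mult act_eq[of m g] act_distrib act_c_pow)
  also have "\<dots> = m \<otimes>\<^bsub>M\<^esub> c [^]\<^bsub>M\<^esub> (b m g + b m h)"
    using m gh c_closed by (simp add: act_eq[of m h] M.int_pow_mult M.m_ac)
  finally show "[b m (g \<otimes> h) = b m g + b m h] (mod int p)"
    using m gh by (intro pairing_eqI) auto
qed

lemma pairing_c_pow: "g \<in> carrier G \<Longrightarrow> [b (c [^]\<^bsub>M\<^esub> (k::int)) g = 0] (mod int p)"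
  by (rule pairing_eqI) (use c_closed in \<open>auto simp: act_c_pow\<close>)

lemma pairing_left_kernel:
  assumes "m \<in> carrier M" and "\<And>g. g \<in> carrier G \<Longrightarrow> [b m g = 0] (mod int p)"
  obtains k :: int where "m = c [^]\<^bsub>M\<^esub> k"
proof -
  have "act m g = m" if "g \<in> carrier G" for g
  proof -
    have "c [^]\<^bsub>M\<^esub> b m g = \<one>\<^bsub>M\<^esub>"
      using c_pow_eq_iff[of "b m g" 0] assms(2)[OF that] by simp
    then show ?thesis using act_eq assms(1) that by simp
  qed
  then have "m \<in> fixed_points G M act"
    using assms(1) by (simp add: fixed_points_def)
  then show thesis using that unfolding fixed_points_eq by blast
qed

text \<open>There are finitely many functions from \<open>G\<close> to \<open>\<int>/p\<close>, and \<open>b m\<close> determines \<open>m\<close> up to a power of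
\<open>c\<close>.\<close>
lemma finite_carrier_M:
  assumes "finite (carrier G)"
  shows "finite (carrier M)"
proof -
  let ?f = "\<lambda>m. \<lambda>g\<in>carrier G. b m g mod int p"
  have "?f ` carrier M \<subseteq> carrier G \<rightarrow>\<^sub>E {0..<int p}"
    using prime_p by (auto simp: prime_gt_0_nat)
  then have img: "finite (?f ` carrier M)"
    using assms by (meson finite_PiE finite_atLeastLessThan_int finite_subset)
  have "finite {m \<in> carrier M. ?f m = ?f m0}" if m0: "m0 \<in> carrier M" for m0
  proof (rule finite_subset)
    show "finite ((\<lambda>k::int. m0 \<otimes>\<^bsub>M\<^esub> c [^]\<^bsub>M\<^esub> k) ` {0..<int p})" by simp
    show "{m \<in> carrier M. ?f m = ?f m0} \<subseteq> (\<lambda>k::int. m0 \<otimes>\<^bsub>M\<^esub> c [^]\<^bsub>M\<^esub> k) ` {0..<int p}"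
    proof clarify
      fix m assume m: "m \<in> carrier M" and eq: "?f m = ?f m0"
      have "[b (inv\<^bsub>M\<^esub> m0 \<otimes>\<^bsub>M\<^esub> m) g = 0] (mod int p)" if g: "g \<in> carrier G" for g
      proof -
        have "[b m g = b m0 g] (mod int p)"
          using fun_cong[OF eq, of g] g by (simp add: cong_def)
        moreover have "[b (inv\<^bsub>M\<^esub> m0) g = - b m0 g] (mod int p)"
          using M.mod_character_inv[OF mod_character_pairing_left[OF g] m0] .
        moreover have "[b (inv\<^bsub>M\<^esub> m0 \<otimes>\<^bsub>M\<^esub> m) g = b (inv\<^bsub>M\<^esub> m0) g + b m g] (mod int p)"
          using mod_character_pairing_left[OF g] m m0 by (simp add: mod_character_def)
        ultimately show ?thesis
          unfolding cong_iff_dvd_diff by Groebner_Basis.algebra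
      qed
      then obtain k :: int where k: "inv\<^bsub>M\<^esub> m0 \<otimes>\<^bsub>M\<^esub> m = c [^]\<^bsub>M\<^esub> k"
        using m m0 by (metis M.inv_closed M.m_closed pairing_left_kernel)
      have "m = m0 \<otimes>\<^bsub>M\<^esub> (inv\<^bsub>M\<^esub> m0 \<otimes>\<^bsub>M\<^esub> m)"
        using m m0 by (simp add: M.m_assoc[symmetric])
      also have "\<dots> = m0 \<otimes>\<^bsub>M\<^esub> c [^]\<^bsub>M\<^esub> (k mod int p)"
        unfolding k using m0 by (simp add: eq_c_pow_iff cong_def)
      finally show "m \<in> (\<lambda>k::int. m0 \<otimes>\<^bsub>M\<^esub> c [^]\<^bsub>M\<^esub> k) ` {0..<int p}"
        using prime_p by (auto simp: prime_gt_0_nat)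
    qed
  qed
  then have "finite (\<Union>y \<in> ?f ` carrier M. {m \<in> carrier M. ?f m = y})"
    using img by (intro finite_UN_I) auto
  moreover have "carrier M \<subseteq> (\<Union>y \<in> ?f ` carrier M. {m \<in> carrier M. ?f m = y})"
    by blast
  ultimately show ?thesis by (rule rev_finite_subset)
qed

text \<open>The pairing \<open>b\<close> does not see the line spanned by \<open>c\<close>. With \<open>\<rho> c = 1\<close>, the second summand makes \<open>c\<close>
represent the character \<open>l\<close>.\<close>
definition twisted_pairing :: "('m \<Rightarrow> int) \<Rightarrow> ('g \<Rightarrow> int) \<Rightarrow> 'm \<Rightarrow> 'g \<Rightarrow> int" where
  "twisted_pairing \<rho> l m g = b m g + \<rho> m * l g"

lemma mod_character_twisted_pairing_left:
  assumes "mod_character p M \<rho>" and "g \<in> carrier G"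
  shows "mod_character p M (\<lambda>m. twisted_pairing \<rho> l m g)"
  unfolding mod_character_def
proof (intro ballI)
  fix m n assume mn: "m \<in> carrier M" "n \<in> carrier M"
  have "[b (m \<otimes>\<^bsub>M\<^esub> n) g = b m g + b n g] (mod int p)" "[\<rho> (m \<otimes>\<^bsub>M\<^esub> n) = \<rho> m + \<rho> n] (mod int p)"
    using mn assms mod_character_pairing_left by (auto simp: mod_character_def)
  then show "[twisted_pairing \<rho> l (m \<otimes>\<^bsub>M\<^esub> n) g = twisted_pairing \<rho> l m g + twisted_pairing \<rho> l n g] (mod int p)"
    unfolding cong_iff_dvd_diff twisted_pairing_def by Groebner_Basis.algebra
qed

lemma mod_character_twisted_pairing_right:
  assumes "mod_character p G l" and "m \<in> carrier M"
  shows "mod_character p G (twisted_pairing \<rho> l m)"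
  unfolding mod_character_def
proof (intro ballI)
  fix g h assume gh: "g \<in> carrier G" "h \<in> carrier G"
  have "[b m (g \<otimes> h) = b m g + b m h] (mod int p)" "[l (g \<otimes> h) = l g + l h] (mod int p)"
    using gh assms mod_character_pairing_right by (auto simp: mod_character_def)
  then show "[twisted_pairing \<rho> l m (g \<otimes> h) = twisted_pairing \<rho> l m g + twisted_pairing \<rho> l m h] (mod int p)"
    unfolding cong_iff_dvd_diff twisted_pairing_def by Groebner_Basis.algebra
qed

lemma twisted_pairing_unique:
  assumes \<rho>: "mod_character p M \<rho>" and N: "subgroup N M"
    and kernel: "\<And>m. \<lbrakk>m \<in> N; \<And>g. g \<in> carrier G \<Longrightarrow> [twisted_pairing \<rho> l m g = 0] (mod int p)\<rbrakk> \<Longrightarrow> m = \<one>\<^bsub>M\<^esub>"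
    and m: "m \<in> N" and n: "n \<in> N"
    and \<chi>m: "\<forall>g\<in>carrier G. [\<chi> g = twisted_pairing \<rho> l m g] (mod int p)"
    and \<chi>n: "\<forall>g\<in>carrier G. [\<chi> g = twisted_pairing \<rho> l n g] (mod int p)"
  shows "m = n"
proof -
  interpret N: subgroup N M by fact
  have "m \<otimes>\<^bsub>M\<^esub> inv\<^bsub>M\<^esub> n = \<one>\<^bsub>M\<^esub>"
  proof (rule kernel)
    fix g assume g: "g \<in> carrier G"
    note hom = mod_character_twisted_pairing_left[OF \<rho> g, of l]
    have "[twisted_pairing \<rho> l (m \<otimes>\<^bsub>M\<^esub> inv\<^bsub>M\<^esub> n) g
        = twisted_pairing \<rho> l m g + twisted_pairing \<rho> l (inv\<^bsub>M\<^esub> n) g] (mod int p)"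
      using hom m n by (auto simp: mod_character_def)
    moreover have "[twisted_pairing \<rho> l (inv\<^bsub>M\<^esub> n) g = - twisted_pairing \<rho> l n g] (mod int p)"
      using M.mod_character_inv[OF hom] n by auto
    ultimately show "[twisted_pairing \<rho> l (m \<otimes>\<^bsub>M\<^esub> inv\<^bsub>M\<^esub> n) g = 0] (mod int p)"
      using bspec[OF \<chi>m g] bspec[OF \<chi>n g] unfolding cong_iff_dvd_diff by Groebner_Basis.algebra
  qed (use m n in auto)
  then show ?thesis
    using m n by (metis M.inv_equality M.inv_inv M.inv_closed N.mem_carrier)
qed

text \<open>If the pairing \<open>b\<close> already represents all characters, then \<open>l = 0\<close> works, and \<open>N\<close> is the kernel of
\<open>\<rho>\<close>, a complement of the kernel of \<open>b\<close>. Otherwise any character \<open>l\<close> that is not represented makes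
the twisted pairing injective on all of \<open>M\<close>; as a character is determined by its values on the
generating set \<open>S\<close>, the hypothesis on the order of \<open>M\<close> turns injectivity into surjectivity.
The uniqueness makes the representing element depend additively on \<open>\<chi>\<close>.\<close>
theorem characters_represented:
  assumes \<rho>: "mod_character p M \<rho>" and \<rho>c: "[\<rho> c = 1] (mod int p)"
    and fin: "finite S" and S: "S \<subseteq> carrier G" and gen: "generate G S = carrier G"
    and card_le: "p ^ card S \<le> card (carrier M)"
  obtains l N where "mod_character p G l" and "subgroup N M"
    and "\<forall>\<chi>. mod_character p G \<chi> \<longrightarrow>
      (\<exists>!m. m \<in> N \<and> (\<forall>g\<in>carrier G. [\<chi> g = twisted_pairing \<rho> l m g] (mod int p)))"
proof (cases "\<forall>\<chi>. mod_character p G \<chi> \<longrightarrow> (\<exists>m\<in>carrier M. \<forall>g\<in>carrier G. [\<chi> g = b m g] (mod int p))")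
  case True
  let ?N = "{m \<in> carrier M. [\<rho> m = 0] (mod int p)}"
  have \<rho>_mult: "[\<rho> (m \<otimes>\<^bsub>M\<^esub> n) = \<rho> m + \<rho> n] (mod int p)" if "m \<in> carrier M" "n \<in> carrier M" for m n
    using \<rho> that by (simp add: mod_character_def)
  have \<rho>_c_pow: "[\<rho> (c [^]\<^bsub>M\<^esub> k) = k] (mod int p)" for k :: int
    using M.mod_character_int_pow[OF \<rho> c_closed, of k] \<rho>c cong_scalar_left[OF \<rho>c, of k]
    by (metis cong_trans mult_1_right)
  have N: "subgroup ?N M"
  proof (rule M.subgroupI)
    fix m assume "m \<in> ?N"
    then show "inv\<^bsub>M\<^esub> m \<in> ?N"
      using M.mod_character_inv[OF \<rho>, of m] by (auto simp: cong_0_iff cong_dvd_iff)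
  next
    fix m n assume "m \<in> ?N" "n \<in> ?N"
    then show "m \<otimes>\<^bsub>M\<^esub> n \<in> ?N"
      using \<rho>_mult[of m n] by (auto simp: cong_0_iff cong_dvd_iff)
  qed (use M.mod_character_one[OF \<rho>] in auto)
  have kernel: "m = \<one>\<^bsub>M\<^esub>"
    if m: "m \<in> ?N" and "\<And>g. g \<in> carrier G \<Longrightarrow> [twisted_pairing \<rho> (\<lambda>_. 0) m g = 0] (mod int p)" for m
  proof -
    have "[b m g = 0] (mod int p)" if "g \<in> carrier G" for g
      using m \<open>\<And>g. g \<in> carrier G \<Longrightarrow> _\<close>[OF that] by (simp add: twisted_pairing_def)
    then obtain k :: int where k: "m = c [^]\<^bsub>M\<^esub> k"
      using pairing_left_kernel m by blast
    then have "[k = 0] (mod int p)"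
      using m \<rho>_c_pow[of k] by (metis (mono_tags, lifting) cong_sym cong_trans mem_Collect_eq)
    then show ?thesis
      using k c_pow_eq_iff[of k 0] by simp
  qed
  show thesis
  proof (rule that[of "\<lambda>_. 0" ?N], goal_cases)
    case 3
    show ?case
    proof (intro allI impI)
      fix \<chi> assume "mod_character p G \<chi>"
      then obtain m where m: "m \<in> carrier M" and \<chi>: "\<And>g. g \<in> carrier G \<Longrightarrow> [\<chi> g = b m g] (mod int p)"
        using True by blast
      let ?m = "m \<otimes>\<^bsub>M\<^esub> c [^]\<^bsub>M\<^esub> - \<rho> m"
      have "[\<rho> ?m = 0] (mod int p)"
        using \<rho>_mult[OF m c_pow_closed, of "- \<rho> m"] \<rho>_c_pow[of "- \<rho> m"]
        unfolding cong_iff_dvd_diff by Groebner_Basis.algebra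
      moreover have "[\<chi> g = twisted_pairing \<rho> (\<lambda>_. 0) ?m g] (mod int p)" if g: "g \<in> carrier G" for g
      proof -
        have "[b ?m g = b m g + b (c [^]\<^bsub>M\<^esub> - \<rho> m) g] (mod int p)"
          using mod_character_pairing_left[OF g] m c_pow_closed by (simp add: mod_character_def)
        then show ?thesis
          using \<chi>[OF g] pairing_c_pow[OF g, of "- \<rho> m"]
          unfolding cong_iff_dvd_diff twisted_pairing_def by Groebner_Basis.algebra
      qed
      ultimately have m': "?m \<in> ?N" "\<forall>g\<in>carrier G. [\<chi> g = twisted_pairing \<rho> (\<lambda>_. 0) ?m g] (mod int p)"
        using m c_pow_closed by auto
      show "\<exists>!m. m \<in> ?N \<and> (\<forall>g\<in>carrier G. [\<chi> g = twisted_pairing \<rho> (\<lambda>_. 0) m g] (mod int p))"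
      proof (rule ex1I, intro conjI)
        fix n assume n: "n \<in> ?N \<and> (\<forall>g\<in>carrier G. [\<chi> g = twisted_pairing \<rho> (\<lambda>_. 0) n g] (mod int p))"
        show "n = ?m"
          by (rule twisted_pairing_unique[OF \<rho> N _ conjunct1[OF n] m'(1) conjunct2[OF n] m'(2)])
            (rule kernel)
      qed (rule m')+
    qed
  qed (use N in \<open>auto simp: mod_character_def\<close>)
next
  case False
  then obtain l where l: "mod_character p G l"
    and not_pairing: "\<And>m. m \<in> carrier M \<Longrightarrow> \<not> (\<forall>g\<in>carrier G. [l g = b m g] (mod int p))"
    by blast
  have kernel: "m = \<one>\<^bsub>M\<^esub>"
    if m: "m \<in> carrier M" and zero: "\<And>g. g \<in> carrier G \<Longrightarrow> [twisted_pairing \<rho> l m g = 0] (mod int p)" for m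
  proof -
    \<comment> \<open>If \<open>\<rho> m\<close> were invertible, a power of \<open>m\<close> would represent \<open>l\<close> through \<open>b\<close> alone.\<close>
    have \<rho>m: "[\<rho> m = 0] (mod int p)"
    proof (rule ccontr)
      assume "\<not> [\<rho> m = 0] (mod int p)"
      then have "coprime (\<rho> m) (int p)"
        using prime_p by (simp add: cong_0_iff coprime_commute[of "\<rho> m"] prime_imp_coprime)
      then obtain j where j: "[\<rho> m * j = 1] (mod int p)"
        using cong_solve_coprime_int by auto
      have "[l g = b (m [^]\<^bsub>M\<^esub> (- j)) g] (mod int p)" if g: "g \<in> carrier G" for g
        using M.mod_character_int_pow[OF mod_character_pairing_left[OF g] m, of "- j"] zero[OF g] j
        unfolding cong_iff_dvd_diff twisted_pairing_def by Groebner_Basis.algebra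
      then show False
        using not_pairing[of "m [^]\<^bsub>M\<^esub> (- j)"] m by blast
    qed
    have "[b m g = 0] (mod int p)" if "g \<in> carrier G" for g
      using zero[OF that] \<rho>m unfolding cong_iff_dvd_diff twisted_pairing_def by Groebner_Basis.algebra
    then obtain k :: int where k: "m = c [^]\<^bsub>M\<^esub> k"
      using pairing_left_kernel m by blast
    then have "[\<rho> m = k * \<rho> c] (mod int p)"
      using M.mod_character_int_pow[OF \<rho> c_closed] by simp
    with \<rho>m \<rho>c have "[k = 0] (mod int p)"
      unfolding cong_iff_dvd_diff by Groebner_Basis.algebra
    then show ?thesis
      using k c_pow_eq_iff[of k 0] by simp
  qed
  have unique: "m = n" if "m \<in> carrier M" "n \<in> carrier M"
    "\<forall>g\<in>carrier G. [\<chi> g = twisted_pairing \<rho> l m g] (mod int p)"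
    "\<forall>g\<in>carrier G. [\<chi> g = twisted_pairing \<rho> l n g] (mod int p)" for \<chi> m n
    by (rule twisted_pairing_unique[OF \<rho> M.subgroup_self _ that]) (rule kernel)
  let ?\<Psi> = "\<lambda>m. \<lambda>s\<in>S. twisted_pairing \<rho> l m s mod int p"
  have agree: "[\<chi> g = \<psi> g] (mod int p)"
    if "mod_character p G \<chi>" "mod_character p G \<psi>" "g \<in> carrier G"
      "\<And>s. s \<in> S \<Longrightarrow> [\<chi> s = \<psi> s] (mod int p)" for \<chi> \<psi> g
    using G.mod_character_cong_on_generate[OF that(1,2) S that(4)] that(3) gen by blast
  have "inj_on ?\<Psi> (carrier M)"
  proof (rule inj_onI)
    fix m n assume mn: "m \<in> carrier M" "n \<in> carrier M" and eq: "?\<Psi> m = ?\<Psi> n"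
    have "[twisted_pairing \<rho> l m s = twisted_pairing \<rho> l n s] (mod int p)" if "s \<in> S" for s
      using fun_cong[OF eq, of s] that by (simp add: cong_def)
    then have "\<forall>g\<in>carrier G. [twisted_pairing \<rho> l m g = twisted_pairing \<rho> l n g] (mod int p)"
      using agree[OF mod_character_twisted_pairing_right[OF l mn(1)]
          mod_character_twisted_pairing_right[OF l mn(2)]] by blast
    then show "m = n"
      using mn by (intro unique[where \<chi> = "twisted_pairing \<rho> l m"]) auto
  qed
  then have "card (?\<Psi> ` carrier M) = card (carrier M)"
    by (rule card_image)
  moreover have "card (S \<rightarrow>\<^sub>E {0..<int p}) = p ^ card S"
    using fin by (simp add: card_PiE)
  moreover have sub: "?\<Psi> ` carrier M \<subseteq> S \<rightarrow>\<^sub>E {0..<int p}"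
    using prime_p by (auto simp: prime_gt_0_nat)
  moreover have "finite (S \<rightarrow>\<^sub>E {0..<int p})"
    using fin by (simp add: finite_PiE)
  ultimately have surj: "?\<Psi> ` carrier M = S \<rightarrow>\<^sub>E {0..<int p}"
    using card_le by (metis card_mono card_subset_eq le_antisym)
  show thesis
  proof (rule that[OF l M.subgroup_self], intro allI impI)
    fix \<chi> assume \<chi>: "mod_character p G \<chi>"
    have "(\<lambda>s\<in>S. \<chi> s mod int p) \<in> S \<rightarrow>\<^sub>E {0..<int p}"
      using prime_p by (auto simp: prime_gt_0_nat)
    then obtain m where m: "m \<in> carrier M" and eq: "(\<lambda>s\<in>S. \<chi> s mod int p) = ?\<Psi> m"
      unfolding surj[symmetric] by blast
    have "[\<chi> s = twisted_pairing \<rho> l m s] (mod int p)" if "s \<in> S" for s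
      using fun_cong[OF eq, of s] that by (simp add: cong_def)
    then have \<chi>m: "\<forall>g\<in>carrier G. [\<chi> g = twisted_pairing \<rho> l m g] (mod int p)"
      using agree[OF \<chi> mod_character_twisted_pairing_right[OF l m]] by blast
    show "\<exists>!m. m \<in> carrier M \<and> (\<forall>g\<in>carrier G. [\<chi> g = twisted_pairing \<rho> l m g] (mod int p))"
    proof (rule ex1I, intro conjI)
      fix n assume n: "n \<in> carrier M \<and> (\<forall>g\<in>carrier G. [\<chi> g = twisted_pairing \<rho> l n g] (mod int p))"
      show "n = m"
        by (rule unique[OF conjunct1[OF n] m conjunct2[OF n] \<chi>m])
    qed (rule m \<chi>m)+
  qed
qed

end

section \<open>Construction of the derivation\<close>


text \<open>The derivation is \<open>f g\<close> times \<open>c\<close> to the power \<open>q g\<close>, where the homomorphism \<open>f\<close> is chosen so that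
the form \<open>b (f g) h\<close> differs from \<open>\<omega> g h\<close> by a symmetric form and \<open>q\<close> has \<open>b (f g) h\<close> as
coboundary. As \<open>z\<close> lies in the radical of \<open>\<omega>\<close> and all characters vanish on the derived subgroup,
\<open>\<delta> z\<close> is \<open>c\<close> to the power \<open>r z\<close>.\<close>
theorem (in cyclic_commutator_module) exists_derivation_nontrivial_on_derived:
  fixes z :: 'g and \<omega> :: "'g \<Rightarrow> 'g \<Rightarrow> int"
  assumes form: "central_commutator_form G p z \<omega>"
    and z_derived: "z \<in> derived G (carrier G)"
    and fin_G: "finite (carrier G)"
    and S: "finite S" "S \<subseteq> carrier G" "generate G S = carrier G"
    and card_le: "p ^ card S \<le> card (carrier M)"
  obtains \<delta> where "is_derivation G M act \<delta>" and "\<delta> z \<noteq> \<one>\<^bsub>M\<^esub>"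
proof -
  interpret G: central_commutator_form G p z \<omega> by fact
  obtain r where r: "\<forall>x\<in>carrier G. \<forall>y\<in>carrier G. [r (x \<otimes> y) = r x + r y + \<omega> x y] (mod int p)"
    and r_z: "\<not> [r z = 0] (mod int p)"
    using G.commutator_form_is_coboundary[OF fin_G] .
  obtain \<rho> where \<rho>: "mod_character p M \<rho>" and \<rho>c: "[\<rho> c = 1] (mod int p)"
    using exists_mod_character[OF prime_p elementary_abelian_M finite_carrier_M[OF fin_G] c_closed c_not_one] .
  obtain l N where l: "mod_character p G l" and N: "subgroup N M"
    and represented: "\<forall>\<chi>. mod_character p G \<chi> \<longrightarrow>
      (\<exists>!m. m \<in> N \<and> (\<forall>g\<in>carrier G. [\<chi> g = twisted_pairing \<rho> l m g] (mod int p)))"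
    using characters_represented[OF \<rho> \<rho>c S card_le] .
  interpret N: subgroup N M by fact
  define rep where "rep \<chi> = (THE m. m \<in> N \<and> (\<forall>g\<in>carrier G. [\<chi> g = twisted_pairing \<rho> l m g] (mod int p)))" for \<chi>
  have rep: "rep \<chi> \<in> N" "\<And>g. g \<in> carrier G \<Longrightarrow> [\<chi> g = b (rep \<chi>) g + \<rho> (rep \<chi>) * l g] (mod int p)"
    if "mod_character p G \<chi>" for \<chi>
    using theI'[OF represented[rule_format, OF that]] unfolding rep_def twisted_pairing_def by auto
  have rep_eqI: "rep \<chi> = m" if "mod_character p G \<chi>" "m \<in> N"
      "\<And>g. g \<in> carrier G \<Longrightarrow> [\<chi> g = twisted_pairing \<rho> l m g] (mod int p)" for \<chi> m
    unfolding rep_def using represented[rule_format, OF that(1)] by (rule the1_equality) (use that in blast)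
  define \<mu> where "\<mu> g = rep (\<omega> g)" for g
  have \<mu>_N: "\<mu> g \<in> N" if "g \<in> carrier G" for g
    unfolding \<mu>_def by (rule rep(1)[OF G.mod_character_form_right[OF that]])
  have \<mu>_closed: "\<mu> g \<in> carrier M" if "g \<in> carrier G" for g
    using \<mu>_N[OF that] by (rule N.mem_carrier)
  have \<mu>: "[\<omega> g h = b (\<mu> g) h + \<rho> (\<mu> g) * l h] (mod int p)" if "g \<in> carrier G" "h \<in> carrier G" for g h
    unfolding \<mu>_def by (rule rep(2)[OF G.mod_character_form_right[OF that(1)] that(2)])
  have \<mu>_mult: "\<mu> (g \<otimes> h) = \<mu> g \<otimes>\<^bsub>M\<^esub> \<mu> h" if gh: "g \<in> carrier G" "h \<in> carrier G" for g h
    unfolding \<mu>_def[of "g \<otimes> h"]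
  proof (rule rep_eqI)
    fix k assume k: "k \<in> carrier G"
    have "[twisted_pairing \<rho> l (\<mu> g \<otimes>\<^bsub>M\<^esub> \<mu> h) k = twisted_pairing \<rho> l (\<mu> g) k + twisted_pairing \<rho> l (\<mu> h) k] (mod int p)"
      using mod_character_twisted_pairing_left[OF \<rho> k, of l] \<mu>_closed gh by (simp add: mod_character_def)
    moreover have "[\<omega> (g \<otimes> h) k = \<omega> g k + \<omega> h k] (mod int p)"
      using G.form_add_left gh k .
    ultimately show "[\<omega> (g \<otimes> h) k = twisted_pairing \<rho> l (\<mu> g \<otimes>\<^bsub>M\<^esub> \<mu> h) k] (mod int p)"
      using \<mu>[OF gh(1) k] \<mu>[OF gh(2) k] unfolding cong_iff_dvd_diff twisted_pairing_def by Groebner_Basis.algebra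
  qed (use gh \<mu>_N G.mod_character_form_right in auto)
  have \<mu>_z: "\<mu> z = \<one>\<^bsub>M\<^esub>"
    unfolding \<mu>_def
  proof (rule rep_eqI)
    fix k assume k: "k \<in> carrier G"
    have "[\<omega> z k = 0] (mod int p)"
      using G.form_z_left[OF k, of 1] G.z_closed by simp
    moreover have "[twisted_pairing \<rho> l \<one>\<^bsub>M\<^esub> k = 0] (mod int p)"
      using M.mod_character_one[OF mod_character_twisted_pairing_left[OF \<rho> k]] .
    ultimately show "[\<omega> z k = twisted_pairing \<rho> l \<one>\<^bsub>M\<^esub> k] (mod int p)"
      using cong_sym cong_trans by blast
  qed (use G.z_closed G.mod_character_form_right in auto)
  define \<phi> where "\<phi> g = \<rho> (\<mu> g)" for g
  have \<phi>: "mod_character p G \<phi>"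
    using \<rho> \<mu>_mult \<mu>_closed by (simp add: mod_character_def \<phi>_def)
  define n where "n = rep \<phi>"
  have n_closed: "n \<in> carrier M"
    unfolding n_def using rep(1)[OF \<phi>] by (rule N.mem_carrier)
  have n: "[\<phi> g = b n g + \<rho> n * l g] (mod int p)" if "g \<in> carrier G" for g
    unfolding n_def by (rule rep(2)[OF \<phi> that])
  \<comment> \<open>The form belonging to \<open>\<mu>\<close> is \<open>\<omega> g h - \<phi> g * l h\<close>. Multiplying by powers of \<open>n\<close> adds the
      mirror image \<open>- l g * \<phi> h\<close> of the second term, up to a multiple of the symmetric \<open>l g * l h\<close>.\<close>
  define f where "f g = \<mu> g \<otimes>\<^bsub>M\<^esub> n [^]\<^bsub>M\<^esub> - l g" for g
  \<comment> \<open>The contributions are a function with coboundary \<open>\<omega>\<close> and half of the quadratic form of the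
      symmetric remainder.\<close>
  define q where "q g = r g - \<phi> g * l g + G.half * \<rho> n * (l g)\<^sup>2" for g
  define \<delta> where "\<delta> g = f g \<otimes>\<^bsub>M\<^esub> c [^]\<^bsub>M\<^esub> q g" for g
  have f_closed: "f g \<in> carrier M" if "g \<in> carrier G" for g
    using \<mu>_closed[OF that] n_closed by (simp add: f_def)
  have f_mult: "f (g \<otimes> h) = f g \<otimes>\<^bsub>M\<^esub> f h" if gh: "g \<in> carrier G" "h \<in> carrier G" for g h
  proof -
    have "[- l (g \<otimes> h) = - l g + - l h] (mod int p)"
      using l gh unfolding mod_character_def cong_iff_dvd_diff by (metis cong_iff_dvd_diff cong_minus_minus_iff minus_add_distrib)
    then have "n [^]\<^bsub>M\<^esub> - l (g \<otimes> h) = n [^]\<^bsub>M\<^esub> - l g \<otimes>\<^bsub>M\<^esub> n [^]\<^bsub>M\<^esub> - l h"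
      using M.int_pow_cong[OF n_closed exponent_M[OF n_closed]] n_closed by (simp add: M.int_pow_mult[symmetric])
    then show ?thesis
      using \<mu>_mult[OF gh] \<mu>_closed gh n_closed by (simp add: f_def M.m_ac)
  qed
  have pairing_f: "[b (f g) h = \<omega> g h - \<phi> g * l h - l g * \<phi> h + \<rho> n * l g * l h] (mod int p)"
    if gh: "g \<in> carrier G" "h \<in> carrier G" for g h
  proof -
    have "[b (f g) h = b (\<mu> g) h + b (n [^]\<^bsub>M\<^esub> - l g) h] (mod int p)"
      using mod_character_pairing_left[OF gh(2)] \<mu>_closed[OF gh(1)] n_closed by (simp add: mod_character_def f_def)
    moreover have "[b (n [^]\<^bsub>M\<^esub> - l g) h = - l g * b n h] (mod int p)"
      by (rule M.mod_character_int_pow[OF mod_character_pairing_left[OF gh(2)] n_closed])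
    ultimately show ?thesis
      using \<mu>[OF gh] n[OF gh(2)] unfolding cong_iff_dvd_diff \<phi>_def[of g] by Groebner_Basis.algebra
  qed
  have q_mult: "[q (g \<otimes> h) = b (f g) h + q g + q h] (mod int p)" if gh: "g \<in> carrier G" "h \<in> carrier G" for g h
  proof -
    have "[\<phi> (g \<otimes> h) = \<phi> g + \<phi> h] (mod int p)" "[l (g \<otimes> h) = l g + l h] (mod int p)"
      using \<phi> l gh by (auto simp: mod_character_def)
    then show ?thesis
      using r[rule_format, OF gh] pairing_f[OF gh] G.two_half unfolding cong_iff_dvd_diff q_def by Groebner_Basis.algebra
  qed
  have "is_derivation G M act \<delta>"
    unfolding is_derivation_def
  proof (intro conjI ballI)
    show "\<delta> \<in> carrier G \<rightarrow> carrier M"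
      using f_closed c_closed by (auto simp: \<delta>_def)
  next
    fix g h assume gh: "g \<in> carrier G" "h \<in> carrier G"
    have "\<delta> (g \<otimes> h) = f g \<otimes>\<^bsub>M\<^esub> f h \<otimes>\<^bsub>M\<^esub> c [^]\<^bsub>M\<^esub> (b (f g) h + q g + q h)"
      using q_mult[OF gh] f_mult[OF gh] f_closed gh eq_c_pow_iff by (simp add: \<delta>_def)
    also have "\<dots> = (f g \<otimes>\<^bsub>M\<^esub> c [^]\<^bsub>M\<^esub> b (f g) h \<otimes>\<^bsub>M\<^esub> c [^]\<^bsub>M\<^esub> q g) \<otimes>\<^bsub>M\<^esub> \<delta> h"
      using f_closed gh c_closed by (simp add: \<delta>_def M.int_pow_mult M.m_ac)
    also have "f g \<otimes>\<^bsub>M\<^esub> c [^]\<^bsub>M\<^esub> b (f g) h \<otimes>\<^bsub>M\<^esub> c [^]\<^bsub>M\<^esub> q g = act (\<delta> g) h"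
      using f_closed gh c_closed by (simp add: \<delta>_def act_distrib act_c_pow act_eq[of "f g" h])
    finally show "\<delta> (g \<otimes> h) = act (\<delta> g) h \<otimes>\<^bsub>M\<^esub> \<delta> h" .
  qed
  moreover have "\<delta> z \<noteq> \<one>\<^bsub>M\<^esub>"
  proof -
    have l_z: "[l z = 0] (mod int p)" and \<phi>_z: "[\<phi> z = 0] (mod int p)"
      using G.mod_character_derived[OF _ z_derived] l \<phi> by auto
    have "[- l z = 0] (mod int p)"
      using l_z by (simp add: cong_0_iff)
    then have "f z = \<one>\<^bsub>M\<^esub>"
      using M.int_pow_cong[OF n_closed exponent_M[OF n_closed], of "- l z" 0] by (simp add: f_def \<mu>_z)
    moreover have "[q z = r z] (mod int p)"
      using l_z \<phi>_z unfolding cong_iff_dvd_diff q_def by Groebner_Basis.algebra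
    then have "\<not> [q z = 0] (mod int p)"
      using r_z cong_sym cong_trans by blast
    ultimately show ?thesis
      using c_closed c_pow_eq_iff[of "q z" 0] by (simp add: \<delta>_def)
  qed
  ultimately show thesis using that by blast
qed

section \<open>Extra-special groups\<close>

text \<open>A finite value of the infimum means that it is taken over a nonempty set of cardinalities.\<close>
lemma generating_set_card_le:
  assumes "min_gens G \<le> enat n"
  obtains S where "finite S" and "S \<subseteq> carrier G" and "generate G S = carrier G" and "card S \<le> n"
proof -
  have "min_gens G < enat (Suc n)"
    using assms by (meson enat_ord_simps(2) lessI order_le_less_trans)
  then obtain S where "finite S" "S \<subseteq> carrier G" "generate G S = carrier G" "card S < Suc n"
    unfolding min_gens_def INF_less_iff by auto
  then show thesis using that by simp
qed

text \<open>Positivity excludes the value \<open>0\<close>, which stands for an infinite exponent.\<close>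
lemma pow_group_exponent_eq_one:
  assumes "group_exponent G > 0" and "x \<in> carrier G"
  shows "x [^]\<^bsub>G\<^esub> group_exponent G = \<one>\<^bsub>G\<^esub>"
proof (cases "\<exists>n::nat>0. \<forall>x \<in> carrier G. x [^]\<^bsub>G\<^esub> n = \<one>\<^bsub>G\<^esub>")
  case True
  then have eq: "group_exponent G = (LEAST n::nat. n > 0 \<and> (\<forall>x \<in> carrier G. x [^]\<^bsub>G\<^esub> n = \<one>\<^bsub>G\<^esub>))"
    unfolding group_exponent_def by (rule if_P)
  show ?thesis
    unfolding eq using LeastI_ex[OF True] assms(2) by blast
next
  case False
  then have "group_exponent G = 0"
    unfolding group_exponent_def by (rule if_not_P)
  with assms(1) show ?thesis by simp
qed

lemma (in right_group_module) subgroup_fixed_points: "subgroup (fixed_points G M act) M"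
proof (rule M.subgroupI)
  have act_one_M: "act \<one>\<^bsub>M\<^esub> g = \<one>\<^bsub>M\<^esub>" if "g \<in> carrier G" for g
    using act_distrib[of "\<one>\<^bsub>M\<^esub>" "\<one>\<^bsub>M\<^esub>" g] act_closed[of "\<one>\<^bsub>M\<^esub>" g] that by simp
  then show "fixed_points G M act \<noteq> {}"
    by (auto simp: fixed_points_def)
  fix m assume "m \<in> fixed_points G M act"
  then have m: "m \<in> carrier M" "\<And>g. g \<in> carrier G \<Longrightarrow> act m g = m"
    by (auto simp: fixed_points_def)
  have "act (inv\<^bsub>M\<^esub> m) g = inv\<^bsub>M\<^esub> m" if g: "g \<in> carrier G" for g
  proof (rule M.inv_equality[symmetric])
    show "act (inv\<^bsub>M\<^esub> m) g \<otimes>\<^bsub>M\<^esub> m = \<one>\<^bsub>M\<^esub>"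
      using act_distrib[of "inv\<^bsub>M\<^esub> m" m g] m g act_one_M[OF g] by simp
  qed (use m g act_closed in auto)
  then show "inv\<^bsub>M\<^esub> m \<in> fixed_points G M act"
    using m by (simp add: fixed_points_def)
qed (auto simp: fixed_points_def act_distrib)

lemma obtain_generator_of_prime_order:
  fixes G (structure)
  assumes "group G" and "Factorial_Ring.prime p" and "subgroup H G" and "card H = p"
    and "\<And>x. x \<in> H \<Longrightarrow> x [^] p = \<one>"
  obtains x where "x \<in> H" and "x \<noteq> \<one>" and "H = range (\<lambda>k::int. x [^] k)"
proof -
  interpret group G by fact
  have "\<not> H \<subseteq> {\<one>}"
    using assms(2,4) card_mono[of "{\<one>}" H] prime_gt_1_nat[OF assms(2)] by auto
  then obtain x where "x \<in> H" "x \<noteq> \<one>" by blast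
  then show thesis
    using that prime_order_subgroup_eq_powers[OF assms(2-4)] assms(5) by blast
qed

theorem lemma2p2:
  fixes p :: nat
    and G :: "('g, 'c) monoid_scheme"
    and M :: "('m, 'd) monoid_scheme"
    and act :: "'m \<Rightarrow> 'g \<Rightarrow> 'm"
  assumes "Factorial_Ring.prime p" and "odd p"
    and "extra_special p G" and "group_exponent G = p"
    and "elementary_abelian p M"
    and "right_group_module G M act"
    and "fixed_points G M act = module_commutator G M act"
    and "card (fixed_points G M act) = p"
    and "min_gens M \<ge> min_gens G"
  shows "\<exists>\<delta>. is_derivation G M act \<delta> \<and> \<delta> ` gamma2 G \<noteq> {\<one>\<^bsub>M\<^esub>}"
proof -
  interpret right_group_module G M act by fact
  have center: "group_center G = gamma2 G" and card_center: "card (gamma2 G) = p"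
    and p_group: "is_p_group p G"
    using assms(3) by (auto simp: extra_special_def)
  have fin_G: "finite (carrier G)"
    using p_group assms(1) unfolding is_p_group_def order_def
    by (metis card.infinite not_prime_0 power_not_zero)
  have exp_G: "x [^]\<^bsub>G\<^esub> p = \<one>\<^bsub>G\<^esub>" if "x \<in> carrier G" for x
    using pow_group_exponent_eq_one[of G x, unfolded assms(4), OF prime_gt_0_nat[OF assms(1)] that] .
  have exp_M: "m [^]\<^bsub>M\<^esub> p = \<one>\<^bsub>M\<^esub>" if "m \<in> carrier M" for m
    using assms(5) that by (simp add: elementary_abelian_def)
  have gamma2_sub: "gamma2 G \<subseteq> carrier G"
    by (rule G.derived_in_carrier) simp
  obtain z where z: "z \<in> gamma2 G" "z \<noteq> \<one>\<^bsub>G\<^esub>" and gamma2_eq: "gamma2 G = range (\<lambda>k::int. z [^]\<^bsub>G\<^esub> k)"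
    using obtain_generator_of_prime_order[OF G.is_group assms(1) G.derived_is_subgroup[OF order_refl] card_center]
      exp_G gamma2_sub by blast
  have z_closed: "z \<in> carrier G" and z_central: "\<And>x. x \<in> carrier G \<Longrightarrow> z \<otimes>\<^bsub>G\<^esub> x = x \<otimes>\<^bsub>G\<^esub> z"
    using z(1) by (auto simp: center[symmetric] group_center_def)
  obtain c where c: "c \<in> fixed_points G M act" "c \<noteq> \<one>\<^bsub>M\<^esub>"
    and fixed_eq: "fixed_points G M act = range (\<lambda>k::int. c [^]\<^bsub>M\<^esub> k)"
    using obtain_generator_of_prime_order[OF M.is_group assms(1) subgroup_fixed_points assms(8)] exp_M
    by (auto simp: fixed_points_def)
  have c_closed: "c \<in> carrier M"
    using c(1) by (simp add: fixed_points_def)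
  have "\<exists>k::int. x \<otimes>\<^bsub>G\<^esub> y = y \<otimes>\<^bsub>G\<^esub> x \<otimes>\<^bsub>G\<^esub> z [^]\<^bsub>G\<^esub> k"
    if xy: "x \<in> carrier G" "y \<in> carrier G" for x y
  proof -
    let ?u = "x \<otimes>\<^bsub>G\<^esub> y \<otimes>\<^bsub>G\<^esub> inv\<^bsub>G\<^esub> x \<otimes>\<^bsub>G\<^esub> inv\<^bsub>G\<^esub> y"
    have "?u \<in> gamma2 G"
      unfolding derived_def using xy by (intro generate.incl) blast
    then have u: "?u \<in> group_center G" and "\<exists>k::int. ?u = z [^]\<^bsub>G\<^esub> k"
      using center gamma2_eq by auto
    then obtain k :: int where k: "?u = z [^]\<^bsub>G\<^esub> k" by blast
    have "inv\<^bsub>G\<^esub> y \<otimes>\<^bsub>G\<^esub> (y \<otimes>\<^bsub>G\<^esub> x) = x"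
      using xy by (simp add: G.m_assoc[symmetric])
    then have "x \<otimes>\<^bsub>G\<^esub> y = ?u \<otimes>\<^bsub>G\<^esub> (y \<otimes>\<^bsub>G\<^esub> x)"
      using xy by (simp add: G.m_assoc)
    also have "\<dots> = y \<otimes>\<^bsub>G\<^esub> x \<otimes>\<^bsub>G\<^esub> ?u"
      using u xy by (simp add: group_center_def)
    finally show ?thesis unfolding k by blast
  qed
  then obtain \<omega> :: "'g \<Rightarrow> 'g \<Rightarrow> int" where \<omega>: "\<And>x y. \<lbrakk>x \<in> carrier G; y \<in> carrier G\<rbrakk> \<Longrightarrow>
      x \<otimes>\<^bsub>G\<^esub> y = y \<otimes>\<^bsub>G\<^esub> x \<otimes>\<^bsub>G\<^esub> z [^]\<^bsub>G\<^esub> \<omega> x y"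
    by metis
  have "\<exists>k::int. act m g = m \<otimes>\<^bsub>M\<^esub> c [^]\<^bsub>M\<^esub> k" if mg: "m \<in> carrier M" "g \<in> carrier G" for m g
  proof -
    have "inv\<^bsub>M\<^esub> m \<otimes>\<^bsub>M\<^esub> act m g \<in> module_commutator G M act"
      using mg unfolding module_commutator_def by blast
    then obtain k :: int where k: "inv\<^bsub>M\<^esub> m \<otimes>\<^bsub>M\<^esub> act m g = c [^]\<^bsub>M\<^esub> k"
      using fixed_eq assms(7) by auto
    have "act m g = m \<otimes>\<^bsub>M\<^esub> (inv\<^bsub>M\<^esub> m \<otimes>\<^bsub>M\<^esub> act m g)"
      using mg act_closed by (simp add: M.m_assoc[symmetric])
    then show ?thesis unfolding k by blast
  qed
  then obtain b :: "'m \<Rightarrow> 'g \<Rightarrow> int" where b: "\<And>m g. \<lbrakk>m \<in> carrier M; g \<in> carrier G\<rbrakk> \<Longrightarrow>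
      act m g = m \<otimes>\<^bsub>M\<^esub> c [^]\<^bsub>M\<^esub> b m g"
    by metis
  have form: "central_commutator_form G p z \<omega>"
    by (intro central_commutator_form.intro central_commutator_form_axioms.intro
        G.is_group assms(1,2) exp_G z_closed z(2) z_central \<omega>)
  interpret cyclic_commutator_module G M act p c b
    by (intro cyclic_commutator_module.intro cyclic_commutator_module_axioms.intro assms(1,5,6) c_closed c(2) fixed_eq b)
  obtain T where T: "finite T" "T \<subseteq> carrier M" "generate M T = carrier M" "p ^ card T \<le> card (carrier M)"
    using exists_small_generating_set[OF assms(1,5) finite_carrier_M[OF fin_G]] .
  then have "min_gens M \<le> enat (card T)"
    unfolding min_gens_def by (intro INF_lower) auto
  then obtain S where S: "finite S" "S \<subseteq> carrier G" "generate G S = carrier G" and "card S \<le> card T"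
    using generating_set_card_le assms(9) order_trans by metis
  then have "p ^ card S \<le> card (carrier M)"
    using T(4) power_increasing[of "card S" "card T" p] prime_gt_0_nat[OF assms(1)] by linarith
  then obtain \<delta> where "is_derivation G M act \<delta>" "\<delta> z \<noteq> \<one>\<^bsub>M\<^esub>"
    using exists_derivation_nontrivial_on_derived[OF form z(1) fin_G S] by blast
  then show ?thesis using z(1) by blast
qed

end
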